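(* There is a one-to-one correspondence between normalized $C^*$-Frobenius algebras $(X,m,\iota)$ in the $C^*$-tensor category of finite-dimensional Hilbert spaces and pairs $(\mathcal A,\omega)$ of finite-dimensional $C^*$-algebras $\mathcal A$ and faithful states $\omega$ on $\mathcal A$. This correspondence identifies $X$ with $\mathcal A$ as unital associative algebras, $\iota^*$ with $\omega$ as functionals, and the antilinear involution $S$ on $X$ defined by $\iota^*(m(v\otimes w))=\langle Sv,w\rangle$, $v,w\in X$, with the Tomita operator of $(\mathcal A,\omega)$ in its GNS representation.
   Context: A normalized $C^*$-Frobenius algebra in the category of finite-dimensional Hilbert spaces (tensor unit $\mathbb C$) is a triple $(X,m,\iota)$ consisting of a finite-dimensional complex Hilbert space $X$ and linear maps $m:X\otimes X\to X$, $\iota:\mathbb C\to X$ (with Hilbert space adjoints $m^*,\iota^*$) satisfying associativity $m(m\otimes1_X)=m(1_X\otimes m)$; unitality $m(\iota\otimes1_X)=1_X=m(1_X\otimes\iota)$; the $C^*$-Frobenius property $(m\otimes1_X)(1_X\otimes m^* )=m^*m=(1_X\otimes m)(m^*\otimes1_X)$; normalization $\iota^*\iota=1_{\mathbb C}$. The unit of the algebra $X$ is $\iota(1)$, the product is $xy=m(x\otimes y)$. Inner products are antilinear in the first argument. For a finite-dimensional $C^*$-algebra $\mathcal A$ with $*$-operation $x\mapsto x^\dagger$ and faithful state $\omega$, the GNS Hilbert space is $\mathcal A$ with scalar product $\langle x,y\rangle=\omega(x^\dagger y)$, with cyclic and separating vector $\Omega=1_{\mathcal A}$, and the Tomita operator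 is the antilinear map $x\Omega\mapsto x^\dagger\Omega$, $x\in\mathcal A$. *)

theory Defs
  imports Complex_Main "HOL-Library.Poly_Mapping" "HOL-Library.Nonpos_Ints"
begin

section \<open>Finite-dimensional complex vector spaces\<close>

class complex_vector = ab_group_add +
  fixes scaleC :: "complex \<Rightarrow> 'a \<Rightarrow> 'a"  (infixr \<open>*\<^sub>C\<close> 75)
  assumes scaleC_add_right: "a *\<^sub>C (x + y) = a *\<^sub>C x + a *\<^sub>C y"
    and scaleC_add_left: "(a + b) *\<^sub>C x = a *\<^sub>C x + b *\<^sub>C x"
    and scaleC_scaleC: "a *\<^sub>C b *\<^sub>C x = (a * b) *\<^sub>C x"
    and scaleC_one: "1 *\<^sub>C x = x"

global_interpretation complex_vector: vector_space "scaleC :: complex \<Rightarrow> 'a \<Rightarrow> 'a::complex_vector"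
  by unfold_locales (rule scaleC_add_right scaleC_add_left scaleC_scaleC scaleC_one)+

class fd_complex_vector = complex_vector +
  assumes finitely_spanned: "\<exists>B. finite B \<and> (\<forall>x. \<exists>c. x = (\<Sum>b\<in>B. c b *\<^sub>C b))"

lemma finite_spanning_set:
  "\<exists>B :: 'a::fd_complex_vector set. finite B \<and> complex_vector.span B = UNIV"
proof -
  obtain B :: "'a set" where B: "finite B" "\<And>x. \<exists>c. x = (\<Sum>b\<in>B. c b *\<^sub>C b)"
    using finitely_spanned by blast
  then have "x \<in> complex_vector.span B" for x
    unfolding complex_vector.span_finite[OF B(1)] by (auto simp: image_iff)
  with B(1) show ?thesis by blast
qed

lemma finitely_spannedI:
  assumes "finite B" "complex_vector.span B = (UNIV :: 'a::complex_vector set)"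
  shows "\<exists>B :: 'a set. finite B \<and> (\<forall>x. \<exists>c. x = (\<Sum>b\<in>B. c b *\<^sub>C b))"
proof -
  have "x \<in> range (\<lambda>c. \<Sum>b\<in>B. c b *\<^sub>C b)" for x
    unfolding complex_vector.span_finite[OF assms(1), symmetric] assms(2) ..
  then have "\<exists>c. x = (\<Sum>b\<in>B. c b *\<^sub>C b)" for x by (simp add: image_iff)
  with assms(1) show ?thesis by (intro exI[of _ B]) simp
qed

abbreviation clinear :: "('a::complex_vector \<Rightarrow> 'b::complex_vector) \<Rightarrow> bool" where
  "clinear \<equiv> Vector_Spaces.linear scaleC scaleC"

definition antilinear :: "('a::complex_vector \<Rightarrow> 'b::complex_vector) \<Rightarrow> bool" where
  "antilinear f \<longleftrightarrow> (\<forall>x y. f (x + y) = f x + f y) \<and> (\<forall>c x. f (c *\<^sub>C x) = cnj c *\<^sub>C f x)"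

lemma clinear_iff:
  "clinear f \<longleftrightarrow> (\<forall>x y. f (x + y) = f x + f y) \<and> (\<forall>c x. f (c *\<^sub>C x) = c *\<^sub>C f x)"
  unfolding Vector_Spaces.linear_iff
  by (auto intro: complex_vector.vector_space_axioms)

lemma clinearI:
  assumes "\<And>x y. f (x + y) = f x + f y" and "\<And>c x. f (c *\<^sub>C x) = c *\<^sub>C f x"
  shows "clinear f"
  using assms by (simp add: clinear_iff)

lemma clinear_add: "clinear f \<Longrightarrow> f (x + y) = f x + f y"
  and clinear_scale: "clinear f \<Longrightarrow> f (c *\<^sub>C x) = c *\<^sub>C f x"
  by (simp_all add: clinear_iff)

lemma clinear_0: "clinear f \<Longrightarrow> f 0 = 0"
  using clinear_add[of f 0 0] by simp

lemma clinear_diff: "clinear f \<Longrightarrow> f (x - y) = f x - f y"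
  using clinear_add[of f "x - y" y] by (simp add: algebra_simps)

lemma clinear_sum: "clinear f \<Longrightarrow> f (\<Sum>i\<in>A. g i) = (\<Sum>i\<in>A. f (g i))"
  by (induction A rule: infinite_finite_induct) (auto simp: clinear_0 clinear_add)

lemma clinear_compose: "clinear f \<Longrightarrow> clinear g \<Longrightarrow> clinear (\<lambda>x. f (g x))"
  by (simp add: clinear_iff)

instantiation complex :: fd_complex_vector
begin

definition scaleC_complex :: "complex \<Rightarrow> complex \<Rightarrow> complex" where
  "scaleC_complex = (*)"

instance
proof
  show "\<exists>B::complex set. finite B \<and> (\<forall>x. \<exists>c. x = (\<Sum>b\<in>B. c b *\<^sub>C b))"
    by (rule exI[of _ "{1}"]) (auto simp: scaleC_complex_def intro!: exI[of _ "\<lambda>_. _"])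
qed (auto simp: scaleC_complex_def algebra_simps)

end

lemma scaleC_complex_mult: "c *\<^sub>C z = c * z" for z :: complex
  by (simp add: scaleC_complex_def)

section \<open>Tensor product of complex vector spaces\<close>

text \<open>The free complex vector space on the pairs, modulo the subspace spanned by the
  bilinearity relations.\<close>

instantiation poly_mapping :: (type, complex_vector) complex_vector
begin

lift_definition scaleC_poly_mapping :: "complex \<Rightarrow> ('a \<Rightarrow>\<^sub>0 'b) \<Rightarrow> ('a \<Rightarrow>\<^sub>0 'b)"
  is "\<lambda>c f k. c *\<^sub>C f k"
  by (erule finite_subset[rotated]) auto

instance
  by standard (transfer; simp add: fun_eq_iff scaleC_add_right scaleC_add_left scaleC_scaleC scaleC_one)+

end

abbreviation free_pair :: "'a \<Rightarrow> 'b \<Rightarrow> ('a \<times> 'b) \<Rightarrow>\<^sub>0 complex" where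
  "free_pair x y \<equiv> Poly_Mapping.single (x, y) 1"

definition tensor_relations :: "(('a::complex_vector \<times> 'b::complex_vector) \<Rightarrow>\<^sub>0 complex) set" where
  "tensor_relations =
     {free_pair (x + x') y - free_pair x y - free_pair x' y | x x' y. True} \<union>
     {free_pair x (y + y') - free_pair x y - free_pair x y' | x y y'. True} \<union>
     {free_pair (c *\<^sub>C x) y - c *\<^sub>C free_pair x y | c x y. True} \<union>
     {free_pair x (c *\<^sub>C y) - c *\<^sub>C free_pair x y | c x y. True}"

definition tensor_eq ::
    "(('a::complex_vector \<times> 'b::complex_vector) \<Rightarrow>\<^sub>0 complex) \<Rightarrow> (('a \<times> 'b) \<Rightarrow>\<^sub>0 complex) \<Rightarrow> bool" where
  "tensor_eq s t \<longleftrightarrow> s - t \<in> complex_vector.span tensor_relations"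

quotient_type (overloaded) ('a, 'b) tensor =
    "('a::complex_vector \<times> 'b::complex_vector) \<Rightarrow>\<^sub>0 complex" / tensor_eq
proof (rule equivpI)
  show "reflp tensor_eq"
    by (rule reflpI) (simp add: tensor_eq_def complex_vector.span_zero)
  show "symp tensor_eq"
    by (rule sympI) (metis tensor_eq_def complex_vector.span_neg minus_diff_eq)
  show "transp tensor_eq"
    by (rule transpI)
      (metis (no_types, lifting) tensor_eq_def complex_vector.span_add diff_add_cancel add_diff_eq)
qed

instantiation tensor :: (complex_vector, complex_vector) complex_vector
begin

lift_definition zero_tensor :: "('a, 'b) tensor" is 0 .

lift_definition plus_tensor :: "('a, 'b) tensor \<Rightarrow> ('a, 'b) tensor \<Rightarrow> ('a, 'b) tensor" is "(+)"
  unfolding tensor_eq_def by (metis (no_types, lifting) add_diff_add complex_vector.span_add)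

lift_definition uminus_tensor :: "('a, 'b) tensor \<Rightarrow> ('a, 'b) tensor" is uminus
  unfolding tensor_eq_def
  by (metis (no_types, lifting) minus_diff_minus complex_vector.span_neg)

lift_definition minus_tensor :: "('a, 'b) tensor \<Rightarrow> ('a, 'b) tensor \<Rightarrow> ('a, 'b) tensor" is "(-)"
  unfolding tensor_eq_def
proof -
  fix s s' t t' :: "('a \<times> 'b) \<Rightarrow>\<^sub>0 complex"
  assume "s - s' \<in> complex_vector.span tensor_relations" "t - t' \<in> complex_vector.span tensor_relations"
  then have "(s - s') - (t - t') \<in> complex_vector.span tensor_relations"
    by (rule complex_vector.span_diff)
  then show "(s - t) - (s' - t') \<in> complex_vector.span tensor_relations"
    by (simp add: algebra_simps)
qed

lift_definition scaleC_tensor :: "complex \<Rightarrow> ('a, 'b) tensor \<Rightarrow> ('a, 'b) tensor" is scaleC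
  unfolding tensor_eq_def
  by (metis complex_vector.scale_right_diff_distrib complex_vector.span_scale)

instance
proof -
  have eq: "tensor_eq s t" if "s = t" for s t :: "('a \<times> 'b) \<Rightarrow>\<^sub>0 complex"
    using that by (simp add: tensor_eq_def complex_vector.span_zero)
  show "OFCLASS(('a, 'b) tensor, complex_vector_class)"
    by standard (transfer, rule eq,
      simp add: algebra_simps scaleC_add_right scaleC_add_left scaleC_scaleC scaleC_one)+
qed

end

lift_definition tensor_vec :: "'a::complex_vector \<Rightarrow> 'b::complex_vector \<Rightarrow> ('a, 'b) tensor"
  (infixr \<open>\<otimes>\<^sub>v\<close> 80) is free_pair .

definition cbilinear ::
    "('a::complex_vector \<Rightarrow> 'b::complex_vector \<Rightarrow> 'c::complex_vector) \<Rightarrow> bool" where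
  "cbilinear b \<longleftrightarrow> (\<forall>x. clinear (b x)) \<and> (\<forall>y. clinear (\<lambda>x. b x y))"

lemma cbilinear_tensor_vec: "cbilinear (\<otimes>\<^sub>v)"
proof -
  have rel: "tensor_eq r s" if "r - s \<in> tensor_relations" for r s :: "('a \<times> 'b) \<Rightarrow>\<^sub>0 complex"
    unfolding tensor_eq_def using that by (rule complex_vector.span_base)
  have "(x + x') \<otimes>\<^sub>v y = x \<otimes>\<^sub>v y + x' \<otimes>\<^sub>v y" for x x' :: 'a and y :: 'b
    by (transfer, rule rel) (unfold tensor_relations_def diff_diff_eq[symmetric], blast)
  moreover have "x \<otimes>\<^sub>v (y + y') = x \<otimes>\<^sub>v y + x \<otimes>\<^sub>v y'" for x :: 'a and y y' :: 'b
    by (transfer, rule rel) (unfold tensor_relations_def diff_diff_eq[symmetric], blast)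
  moreover have "(c *\<^sub>C x) \<otimes>\<^sub>v y = c *\<^sub>C (x \<otimes>\<^sub>v y)" for x :: 'a and y :: 'b and c
    by (transfer, rule rel) (unfold tensor_relations_def, blast)
  moreover have "x \<otimes>\<^sub>v (c *\<^sub>C y) = c *\<^sub>C (x \<otimes>\<^sub>v y)" for x :: 'a and y :: 'b and c
    by (transfer, rule rel) (unfold tensor_relations_def, blast)
  ultimately show ?thesis
    by (simp add: cbilinear_def clinear_iff)
qed

lemmas tensor_vec_simps = cbilinear_tensor_vec[unfolded cbilinear_def clinear_iff, THEN conjunct2,
    THEN spec, THEN conjunct1, THEN spec, THEN spec]
  cbilinear_tensor_vec[unfolded cbilinear_def clinear_iff, THEN conjunct1,
    THEN spec, THEN conjunct1, THEN spec, THEN spec]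
  cbilinear_tensor_vec[unfolded cbilinear_def clinear_iff, THEN conjunct2,
    THEN spec, THEN conjunct2, THEN spec, THEN spec]
  cbilinear_tensor_vec[unfolded cbilinear_def clinear_iff, THEN conjunct1,
    THEN spec, THEN conjunct2, THEN spec, THEN spec]

lemma tensor_vec_span:
  "complex_vector.span {x \<otimes>\<^sub>v y | x y. True} = (UNIV :: ('a::complex_vector, 'b::complex_vector) tensor set)"
proof -
  let ?V = "complex_vector.span {x \<otimes>\<^sub>v y | (x::'a) (y::'b). True}"
  have "abs_tensor s \<in> ?V" for s :: "('a \<times> 'b) \<Rightarrow>\<^sub>0 complex"
  proof (induction s rule: update_induct)
    case const
    show ?case
      by (simp add: zero_tensor_def[symmetric] complex_vector.span_zero)
  next
    case (update f k v)
    have "Poly_Mapping.update k v f = f + v *\<^sub>C free_pair (fst k) (snd k)"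
      using update(1) by transfer (auto simp: fun_eq_iff scaleC_complex_mult when_def)
    then have "abs_tensor (Poly_Mapping.update k v f) = abs_tensor f + v *\<^sub>C (fst k \<otimes>\<^sub>v snd k)"
      by (simp add: plus_tensor.abs_eq scaleC_tensor.abs_eq tensor_vec.abs_eq)
    then show ?case
      using update(3)
      by (metis (mono_tags, lifting) complex_vector.span_add complex_vector.span_scale
          complex_vector.span_base mem_Collect_eq)
  qed
  then have "t \<in> ?V" for t
    by (rule tensor.abs_induct)
  then show ?thesis by auto
qed

lemma tensor_induct [case_names vec add]:
  assumes "\<And>x y. P (x \<otimes>\<^sub>v y)" and "\<And>s t. P s \<Longrightarrow> P t \<Longrightarrow> P (s + t)"
  shows "P t"
proof -
  have bl: "c *\<^sub>C (x \<otimes>\<^sub>v y) = (c *\<^sub>C x) \<otimes>\<^sub>v y" for c and x :: 'a and y :: 'b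
    by (simp add: tensor_vec_simps)
  have "t \<in> complex_vector.span {x \<otimes>\<^sub>v y | x y. True}"
    using tensor_vec_span by blast
  then show ?thesis
  proof (induction rule: complex_vector.span_induct_alt)
    case base
    have "(0::'a) \<otimes>\<^sub>v (0::'b) = 0"
      using bl[of 0 0 0] by simp
    then show ?case using assms(1)[of 0 0] by simp
  next
    case (step c x y)
    then show ?case using assms bl by force
  qed
qed

lemma clinear_tensor_eqI:
  assumes "clinear f" "clinear g" "\<And>x y. f (x \<otimes>\<^sub>v y) = g (x \<otimes>\<^sub>v y)"
  shows "f = g"
proof
  fix t show "f t = g t"
    by (induction t rule: tensor_induct) (simp_all add: assms clinear_add)
qed

lemma tensor_universal:
  fixes b :: "'a::complex_vector \<Rightarrow> 'b::complex_vector \<Rightarrow> 'c::complex_vector"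
  assumes "cbilinear b"
  shows "\<exists>!f. clinear f \<and> (\<forall>x y. f (x \<otimes>\<^sub>v y) = b x y)"
proof -
  define F where "F s = (\<Sum>p\<in>Poly_Mapping.keys s. Poly_Mapping.lookup s p *\<^sub>C b (fst p) (snd p))" for s :: "('a \<times> 'b) \<Rightarrow>\<^sub>0 complex"
  have F_sup: "F s = (\<Sum>p\<in>A. Poly_Mapping.lookup s p *\<^sub>C b (fst p) (snd p))" if "finite A" "Poly_Mapping.keys s \<subseteq> A" for s A
    unfolding F_def
  proof (intro sum.mono_neutral_left ballI that)
    fix p assume "p \<in> A - Poly_Mapping.keys s"
    then have "Poly_Mapping.lookup s p = 0" using in_keys_iff[of p s] by blast
    then show "Poly_Mapping.lookup s p *\<^sub>C b (fst p) (snd p) = 0" by simp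
  qed
  have F_add: "F (s + t) = F s + F t" for s t
  proof -
    have k: "finite (Poly_Mapping.keys s \<union> Poly_Mapping.keys t)" "Poly_Mapping.keys (s + t) \<subseteq> Poly_Mapping.keys s \<union> Poly_Mapping.keys t"
      using keys_add[of s t] by auto
    show ?thesis
      by (subst (1 2 3) F_sup[OF k(1)]) (use k(2) in \<open>auto simp: lookup_add scaleC_add_left sum.distrib\<close>)
  qed
  have lookup_scale: "Poly_Mapping.lookup (c *\<^sub>C s) p = c * Poly_Mapping.lookup s p" for c and s :: "('a \<times> 'b) \<Rightarrow>\<^sub>0 complex" and p
    by transfer (simp add: scaleC_complex_mult)
  have F_scale: "F (c *\<^sub>C s) = c *\<^sub>C F s" for c s
  proof -
    have k: "Poly_Mapping.keys (c *\<^sub>C s) \<subseteq> Poly_Mapping.keys s"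
      by (auto simp: in_keys_iff lookup_scale)
    show ?thesis
      by (subst (1 2) F_sup[OF finite_keys[of s]])
        (use k in \<open>auto simp: lookup_scale complex_vector.scale_sum_right scaleC_scaleC\<close>)
  qed
  have F_lin: "clinear F"
    by (rule clinearI) (fact F_add F_scale)+
  have F_pair: "F (free_pair x y) = b x y" for x y
    by (simp add: F_def scaleC_one)
  have bl: "b (x + x') y = b x y + b x' y" "b x (y + y') = b x y + b x y'"
    "b (c *\<^sub>C x) y = c *\<^sub>C b x y" "b x (c *\<^sub>C y) = c *\<^sub>C b x y" for x x' y y' c
    using assms by (auto simp: cbilinear_def clinear_iff)
  have F_rel: "F r = 0" if "r \<in> tensor_relations" for r
    using that unfolding tensor_relations_def
    by (auto simp: clinear_diff[OF F_lin] F_pair F_scale bl)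
  have F_span: "F r = 0" if "r \<in> complex_vector.span tensor_relations" for r
    using that
    by (induction rule: complex_vector.span_induct_alt)
      (auto simp: clinear_0[OF F_lin] F_add F_scale F_rel)
  define f where "f t = F (rep_tensor t)" for t
  have f_abs: "f (abs_tensor s) = F s" for s
  proof -
    have "tensor_eq (rep_tensor (abs_tensor s)) s"
      using rep_abs_rsp_left[OF Quotient3_tensor, of s s]
      by (simp add: tensor_eq_def complex_vector.span_zero)
    then have "F (rep_tensor (abs_tensor s) - s) = 0"
      by (intro F_span) (simp add: tensor_eq_def)
    then show ?thesis
      by (simp add: f_def clinear_diff[OF F_lin])
  qed
  have f_add: "f (s + t) = f s + f t" for s t
    by (induction s rule: tensor.abs_induct, induction t rule: tensor.abs_induct)
      (simp add: plus_tensor.abs_eq f_abs F_add)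
  have f_scale: "f (c *\<^sub>C t) = c *\<^sub>C f t" for c t
    by (induction t rule: tensor.abs_induct) (simp add: scaleC_tensor.abs_eq f_abs F_scale)
  show ?thesis
  proof (rule ex1I[of _ f])
    show "clinear f \<and> (\<forall>x y. f (x \<otimes>\<^sub>v y) = b x y)"
      by (auto intro!: clinearI simp: f_add f_scale tensor_vec.abs_eq f_abs F_pair)
    then show "g = f" if "clinear g \<and> (\<forall>x y. g (x \<otimes>\<^sub>v y) = b x y)" for g
      using that by (intro clinear_tensor_eqI) auto
  qed
qed

definition tensor_lift ::
    "('a::complex_vector \<Rightarrow> 'b::complex_vector \<Rightarrow> 'c::complex_vector) \<Rightarrow> ('a, 'b) tensor \<Rightarrow> 'c" where
  "tensor_lift b = (THE f. clinear f \<and> (\<forall>x y. f (x \<otimes>\<^sub>v y) = b x y))"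

lemma clinear_tensor_lift: "cbilinear b \<Longrightarrow> clinear (tensor_lift b)"
  and tensor_lift_vec: "cbilinear b \<Longrightarrow> tensor_lift b (x \<otimes>\<^sub>v y) = b x y"
  unfolding tensor_lift_def by (auto dest!: tensor_universal theI')

definition tensor_map ::
    "('a::complex_vector \<Rightarrow> 'c::complex_vector) \<Rightarrow> ('b::complex_vector \<Rightarrow> 'd::complex_vector) \<Rightarrow>
     ('a, 'b) tensor \<Rightarrow> ('c, 'd) tensor"  (infixr \<open>\<otimes>\<^sub>l\<close> 80) where
  "f \<otimes>\<^sub>l g = tensor_lift (\<lambda>x y. f x \<otimes>\<^sub>v g y)"

definition associator ::
    "(('a::complex_vector, 'b::complex_vector) tensor, 'c::complex_vector) tensor \<Rightarrow>
     ('a, ('b, 'c) tensor) tensor" where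
  "associator = tensor_lift (\<lambda>t z. tensor_lift (\<lambda>x y. x \<otimes>\<^sub>v y \<otimes>\<^sub>v z) t)"

definition associator_inv ::
    "('a::complex_vector, ('b::complex_vector, 'c::complex_vector) tensor) tensor \<Rightarrow>
     (('a, 'b) tensor, 'c) tensor" where
  "associator_inv = tensor_lift (\<lambda>x. tensor_lift (\<lambda>y z. (x \<otimes>\<^sub>v y) \<otimes>\<^sub>v z))"

definition left_unitor :: "(complex, 'a::complex_vector) tensor \<Rightarrow> 'a" where
  "left_unitor = tensor_lift (\<lambda>c x. c *\<^sub>C x)"

definition right_unitor :: "('a::complex_vector, complex) tensor \<Rightarrow> 'a" where
  "right_unitor = tensor_lift (\<lambda>x c. c *\<^sub>C x)"

lemma tensor_map_vec:
  assumes "clinear f" "clinear g"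
  shows "clinear (f \<otimes>\<^sub>l g)" "(f \<otimes>\<^sub>l g) (x \<otimes>\<^sub>v y) = f x \<otimes>\<^sub>v g y"
proof -
  have "cbilinear (\<lambda>x y. f x \<otimes>\<^sub>v g y)"
    using assms by (simp add: cbilinear_def clinear_iff tensor_vec_simps)
  then show "clinear (f \<otimes>\<^sub>l g)" "(f \<otimes>\<^sub>l g) (x \<otimes>\<^sub>v y) = f x \<otimes>\<^sub>v g y"
    by (simp_all add: tensor_map_def clinear_tensor_lift tensor_lift_vec)
qed

lemma associator_vec:
  fixes x :: "'a::complex_vector" and y :: "'b::complex_vector" and z :: "'c::complex_vector"
  shows "clinear (associator :: (('a, 'b) tensor, 'c) tensor \<Rightarrow> _)"
    "associator ((x \<otimes>\<^sub>v y) \<otimes>\<^sub>v z) = x \<otimes>\<^sub>v y \<otimes>\<^sub>v z"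
proof -
  have b: "cbilinear (\<lambda>x y. x \<otimes>\<^sub>v y \<otimes>\<^sub>v z)" for z :: 'c
    by (simp add: cbilinear_def clinear_iff tensor_vec_simps)
  have v: "tensor_lift (\<lambda>x y. x \<otimes>\<^sub>v y \<otimes>\<^sub>v z) (x \<otimes>\<^sub>v y) = x \<otimes>\<^sub>v y \<otimes>\<^sub>v z" for x :: 'a and y :: 'b and z :: 'c
    by (rule tensor_lift_vec[OF b])
  note l = clinear_tensor_lift[OF b]
  have "tensor_lift (\<lambda>x y. x \<otimes>\<^sub>v y \<otimes>\<^sub>v (z + z')) t =
      tensor_lift (\<lambda>x y. x \<otimes>\<^sub>v y \<otimes>\<^sub>v z) t + tensor_lift (\<lambda>x y. x \<otimes>\<^sub>v y \<otimes>\<^sub>v z') t"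
    for z z' :: 'c and t :: "('a, 'b) tensor"
  proof (induction t rule: tensor_induct)
    case (vec x y)
    show ?case unfolding v by (simp add: tensor_vec_simps)
  next
    case (add s t)
    then show ?case unfolding clinear_add[OF l] by (simp add: ac_simps)
  qed
  moreover have "tensor_lift (\<lambda>x y. x \<otimes>\<^sub>v y \<otimes>\<^sub>v (c *\<^sub>C z)) t = c *\<^sub>C tensor_lift (\<lambda>x y. x \<otimes>\<^sub>v y \<otimes>\<^sub>v z) t"
    for c and z :: 'c and t :: "('a, 'b) tensor"
  proof (induction t rule: tensor_induct)
    case (vec x y)
    show ?case unfolding v by (simp add: tensor_vec_simps)
  next
    case (add s t)
    then show ?case unfolding clinear_add[OF l] by (simp add: scaleC_add_right)
  qed
  ultimately have "cbilinear (\<lambda>(t :: ('a, 'b) tensor) (z :: 'c). tensor_lift (\<lambda>x y. x \<otimes>\<^sub>v y \<otimes>\<^sub>v z) t)"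
    unfolding cbilinear_def by (intro conjI allI l) (rule clinearI)
  then show "clinear (associator :: (('a, 'b) tensor, 'c) tensor \<Rightarrow> _)"
    "associator ((x \<otimes>\<^sub>v y) \<otimes>\<^sub>v z) = x \<otimes>\<^sub>v y \<otimes>\<^sub>v z"
    by (simp_all add: associator_def clinear_tensor_lift tensor_lift_vec v)
qed

lemma associator_inv_vec:
  fixes x :: "'a::complex_vector" and y :: "'b::complex_vector" and z :: "'c::complex_vector"
  shows "clinear (associator_inv :: _ \<Rightarrow> (('a, 'b) tensor, 'c) tensor)"
    "associator_inv (x \<otimes>\<^sub>v y \<otimes>\<^sub>v z) = (x \<otimes>\<^sub>v y) \<otimes>\<^sub>v z"
proof -
  have b: "cbilinear (\<lambda>y z. (x \<otimes>\<^sub>v y) \<otimes>\<^sub>v z)" for x :: 'a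
    by (simp add: cbilinear_def clinear_iff tensor_vec_simps)
  have v: "tensor_lift (\<lambda>y z. (x \<otimes>\<^sub>v y) \<otimes>\<^sub>v z) (y \<otimes>\<^sub>v z) = (x \<otimes>\<^sub>v y) \<otimes>\<^sub>v z" for x :: 'a and y :: 'b and z :: 'c
    by (rule tensor_lift_vec[OF b])
  note l = clinear_tensor_lift[OF b]
  have "tensor_lift (\<lambda>y z. ((x + x') \<otimes>\<^sub>v y) \<otimes>\<^sub>v z) t =
      tensor_lift (\<lambda>y z. (x \<otimes>\<^sub>v y) \<otimes>\<^sub>v z) t + tensor_lift (\<lambda>y z. (x' \<otimes>\<^sub>v y) \<otimes>\<^sub>v z) t"
    for x x' :: 'a and t :: "('b, 'c) tensor"
  proof (induction t rule: tensor_induct)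
    case (vec x y)
    show ?case unfolding v by (simp add: tensor_vec_simps)
  next
    case (add s t)
    then show ?case unfolding clinear_add[OF l] by (simp add: ac_simps)
  qed
  moreover have "tensor_lift (\<lambda>y z. ((c *\<^sub>C x) \<otimes>\<^sub>v y) \<otimes>\<^sub>v z) t = c *\<^sub>C tensor_lift (\<lambda>y z. (x \<otimes>\<^sub>v y) \<otimes>\<^sub>v z) t"
    for c and x :: 'a and t :: "('b, 'c) tensor"
  proof (induction t rule: tensor_induct)
    case (vec x y)
    show ?case unfolding v by (simp add: tensor_vec_simps)
  next
    case (add s t)
    then show ?case unfolding clinear_add[OF l] by (simp add: scaleC_add_right)
  qed
  ultimately have "cbilinear (\<lambda>(x :: 'a). tensor_lift (\<lambda>(y :: 'b) (z :: 'c). (x \<otimes>\<^sub>v y) \<otimes>\<^sub>v z))"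
    unfolding cbilinear_def by (intro conjI allI l) (rule clinearI)
  then show "clinear (associator_inv :: _ \<Rightarrow> (('a, 'b) tensor, 'c) tensor)"
    "associator_inv (x \<otimes>\<^sub>v y \<otimes>\<^sub>v z) = (x \<otimes>\<^sub>v y) \<otimes>\<^sub>v z"
    by (simp_all add: associator_inv_def clinear_tensor_lift tensor_lift_vec v)
qed

lemma unitor_vec:
  fixes x :: "'a::complex_vector"
  shows "left_unitor (c \<otimes>\<^sub>v x) = c *\<^sub>C x" "right_unitor (x \<otimes>\<^sub>v c) = c *\<^sub>C x"
    "clinear (left_unitor :: _ \<Rightarrow> 'a)" "clinear (right_unitor :: _ \<Rightarrow> 'a)"
proof -
  have b: "cbilinear (\<lambda>c (x :: 'a). c *\<^sub>C x)" "cbilinear (\<lambda>(x :: 'a) c. c *\<^sub>C x)"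
    by (auto simp: cbilinear_def clinear_iff scaleC_add_left scaleC_add_right scaleC_scaleC
        scaleC_complex_mult mult.commute)
  then show "left_unitor (c \<otimes>\<^sub>v x) = c *\<^sub>C x" "right_unitor (x \<otimes>\<^sub>v c) = c *\<^sub>C x"
    "clinear (left_unitor :: _ \<Rightarrow> 'a)" "clinear (right_unitor :: _ \<Rightarrow> 'a)"
    by (simp_all add: left_unitor_def right_unitor_def tensor_lift_vec clinear_tensor_lift)
qed

instance tensor :: (fd_complex_vector, fd_complex_vector) fd_complex_vector
proof
  obtain B :: "'a set" where B: "finite B" "complex_vector.span B = UNIV"
    using finite_spanning_set by blast
  obtain C :: "'b set" where C: "finite C" "complex_vector.span C = UNIV"
    using finite_spanning_set by blast
  let ?D = "(\<lambda>(x, y). x \<otimes>\<^sub>v y) ` (B \<times> C)"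
  have 1: "x \<otimes>\<^sub>v y \<in> complex_vector.span ?D" if "x \<in> B" for x y
  proof -
    have "y \<in> complex_vector.span C" using C by auto
    then show ?thesis
    proof (induction rule: complex_vector.span_induct_alt)
      case base
      have "x \<otimes>\<^sub>v (0::'b) = 0"
        using tensor_vec_simps(4)[of x 0 "0::'b"] by simp
      then show ?case by (simp add: complex_vector.span_zero)
    next
      case (step c u v)
      have "x \<otimes>\<^sub>v u \<in> ?D" using step(1) that by auto
      with step(2) show ?case
        by (simp add: tensor_vec_simps complex_vector.span_add complex_vector.span_scale
            complex_vector.span_base)
    qed
  qed
  have 2: "x \<otimes>\<^sub>v y \<in> complex_vector.span ?D" for x y
  proof -
    have "x \<in> complex_vector.span B" using B by auto
    then show ?thesis
    proof (induction rule: complex_vector.span_induct_alt)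
      case base
      have "(0::'a) \<otimes>\<^sub>v y = 0"
        using tensor_vec_simps(3)[of 0 "0::'a" y] by simp
      then show ?case by (simp add: complex_vector.span_zero)
    next
      case (step c u v)
      with 1[of u y] show ?case
        by (simp add: tensor_vec_simps complex_vector.span_add complex_vector.span_scale)
    qed
  qed
  have "t \<in> complex_vector.span ?D" for t
    by (induction t rule: tensor_induct) (simp_all add: 2 complex_vector.span_add)
  then have "complex_vector.span ?D = UNIV" by blast
  with B C show "\<exists>D :: ('a, 'b) tensor set. finite D \<and> (\<forall>x. \<exists>c. x = (\<Sum>b\<in>D. c b *\<^sub>C b))"
    by (intro finitely_spannedI[of ?D]) auto
qed

section \<open>Hilbert space structures\<close>

text \<open>A finite-dimensional Hilbert space is given by an inner product on a finite-dimensional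
  complex vector space; completeness is automatic.  The inner product is a variable
  rather than a class constant, since the correspondence constructs it from algebraic data.\<close>

type_synonym 'a cinner = "'a \<Rightarrow> 'a \<Rightarrow> complex"

definition is_cinner :: "'a::complex_vector cinner \<Rightarrow> bool" where
  "is_cinner I \<longleftrightarrow> (\<forall>x. clinear (I x)) \<and> (\<forall>x y. I y x = cnj (I x y)) \<and>
     (\<forall>x. I x x \<in> \<real>\<^sub>\<ge>\<^sub>0) \<and> (\<forall>x. I x x = 0 \<longrightarrow> x = 0)"

definition scalar_inner :: "complex cinner" where
  "scalar_inner a b = cnj a * b"

text \<open>The sesquilinear form with \<open>\<langle>x \<otimes> y, x' \<otimes> y'\<rangle> = \<langle>x, x'\<rangle> \<langle>y, y'\<rangle>\<close>; the
  conjugations make the two nested lifts linear.\<close>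

definition tensor_inner ::
    "'a::complex_vector cinner \<Rightarrow> 'b::complex_vector cinner \<Rightarrow> ('a, 'b) tensor cinner" where
  "tensor_inner I J s t =
     cnj (tensor_lift (\<lambda>x y. cnj (tensor_lift (\<lambda>x' y'. I x x' * J y y') t)) s)"

definition adjoint ::
    "'a::complex_vector cinner \<Rightarrow> 'b::complex_vector cinner \<Rightarrow> ('a \<Rightarrow> 'b) \<Rightarrow> 'b \<Rightarrow> 'a" where
  "adjoint I J f = (THE g. \<forall>x y. J (f x) y = I x (g y))"

lemma clinear_cinner: "is_cinner I \<Longrightarrow> clinear (I x)"
  and cinner_commute: "is_cinner I \<Longrightarrow> I y x = cnj (I x y)"
  and cinner_eq_0: "is_cinner I \<Longrightarrow> I x x = 0 \<Longrightarrow> x = 0"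
  unfolding is_cinner_def by blast+

lemma cinner_self:
  assumes "is_cinner I"
  shows "I x x = complex_of_real (Re (I x x))" "0 \<le> Re (I x x)"
proof -
  have "I x x \<in> \<real>\<^sub>\<ge>\<^sub>0" using assms unfolding is_cinner_def by blast
  then obtain r where "I x x = of_real r" "r \<ge> 0"
    unfolding nonneg_Reals_def by blast
  then show "I x x = complex_of_real (Re (I x x))" "0 \<le> Re (I x x)" by simp_all
qed

lemma cinner_simps:
  assumes "is_cinner I"
  shows "I x (y + z) = I x y + I x z" "I x (c *\<^sub>C y) = c * I x y" "I (x + y) z = I x z + I y z"
    "I (c *\<^sub>C x) y = cnj c * I x y"
proof -
  show 1: "I x (y + z) = I x y + I x z" "I x (c *\<^sub>C y) = c * I x y" for x y z c
    using clinear_cinner[OF assms, of x] by (simp_all add: clinear_iff scaleC_complex_mult)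
  note c = cinner_commute[OF assms]
  have "I (x + y) z = cnj (I z (x + y))" by (rule c)
  also have "\<dots> = I x z + I y z" by (simp add: 1 c[symmetric])
  finally show "I (x + y) z = I x z + I y z" .
  have "I (c *\<^sub>C x) y = cnj (I y (c *\<^sub>C x))" by (rule c)
  also have "\<dots> = cnj c * I x y" by (simp add: 1 c[symmetric])
  finally show "I (c *\<^sub>C x) y = cnj c * I x y" .
qed

lemma cinner_sum_right: "is_cinner I \<Longrightarrow> I x (\<Sum>i\<in>A. f i) = (\<Sum>i\<in>A. I x (f i))"
  by (rule clinear_sum) (rule clinear_cinner)

lemma cinner_sum_left:
  assumes "is_cinner I"
  shows "I (\<Sum>i\<in>A. f i) x = (\<Sum>i\<in>A. I (f i) x)"
proof -
  have "I (\<Sum>i\<in>A. f i) x = (\<Sum>i\<in>A. cnj (I x (f i)))"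
    by (subst cinner_commute[OF assms]) (simp add: cinner_sum_right[OF assms])
  also have "\<dots> = (\<Sum>i\<in>A. I (f i) x)"
    by (intro sum.cong refl cinner_commute[OF assms, symmetric])
  finally show ?thesis .
qed

lemma cinner_eqI:
  assumes "is_cinner I" "\<And>x. I x y = I x z"
  shows "y = z"
proof -
  have d: "I x (y - z) = I x y - I x z" for x
    by (intro clinear_diff clinear_cinner assms(1))
  have "I (y - z) (y - z) = 0"
    using assms(2) by (simp add: d)
  then show ?thesis
    using cinner_eq_0[OF assms(1), of "y - z"] by simp
qed

definition orthonormal_basis :: "'a::complex_vector cinner \<Rightarrow> 'a set \<Rightarrow> bool" where
  "orthonormal_basis I B \<longleftrightarrow> finite B \<and> (\<forall>b\<in>B. \<forall>c\<in>B. I b c = (if b = c then 1 else 0)) \<and>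
     (\<forall>x. x = (\<Sum>b\<in>B. I b x *\<^sub>C b))"

lemma orthonormal_basis_exists:
  fixes I :: "'a::fd_complex_vector cinner"
  assumes "is_cinner I"
  shows "\<exists>B. orthonormal_basis I B"
proof -
  note ip = cinner_simps[OF assms]
  obtain S :: "'a set" where S: "finite S" "complex_vector.span S = UNIV"
    using finite_spanning_set by blast
  have "\<exists>B. finite B \<and> (\<forall>b\<in>B. \<forall>c\<in>B. I b c = (if b = c then 1 else 0)) \<and>
      (\<forall>x\<in>complex_vector.span S. x = (\<Sum>b\<in>B. I b x *\<^sub>C b))"
    using S(1)
  proof (induction S rule: finite_induct)
    case empty
    then show ?case by (intro exI[of _ "{}"]) simp
  next
    case (insert s S)
    then obtain B where B: "finite B" "\<And>b c. b \<in> B \<Longrightarrow> c \<in> B \<Longrightarrow> I b c = (if b = c then 1 else 0)"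
      "\<And>x. x \<in> complex_vector.span S \<Longrightarrow> x = (\<Sum>b\<in>B. I b x *\<^sub>C b)" by blast
    define P where "P x = (\<Sum>b\<in>B. I b x *\<^sub>C b)" for x
    have P_lin: "P (x + y) = P x + P y" "P (c *\<^sub>C x) = c *\<^sub>C P x" for x y c
      by (simp_all add: P_def ip scaleC_add_left sum.distrib complex_vector.scale_sum_right scaleC_scaleC)
    define r where "r = s - P s"
    have I_P: "I b (P x) = I b x" if "b \<in> B" for b x
    proof -
      have "I b (P x) = (\<Sum>c\<in>B. I c x * I b c)"
        by (simp add: P_def cinner_sum_right[OF assms] ip)
      also have "\<dots> = (\<Sum>c\<in>B. if b = c then I c x else 0)"
        using B(2) that by (intro sum.cong) auto
      finally show ?thesis using B(1) that by simp
    qed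
    have orth: "I b r = 0" if "b \<in> B" for b
    proof -
      have "I b s = I b (r + P s)" by (simp add: r_def)
      then show ?thesis using I_P[OF that, of s] by (simp only: ip(1)) simp
    qed
    show ?case
    proof (cases "r = 0")
      case True
      have "x = P x" if "x \<in> complex_vector.span (insert s S)" for x
        using that
      proof (induction rule: complex_vector.span_induct_alt)
        case base
        then show ?case using P_lin(2)[of 0 0] by simp
      next
        case (step c x y)
        have "x = P x"
          using step(1) True B(3)[of x] by (auto simp: r_def P_def[symmetric] complex_vector.span_base)
        then show ?case using step by (simp add: P_lin)
      qed
      then show ?thesis using B(1,2) by (intro exI[of _ B]) (simp add: P_def[symmetric])
    next
      case False
      define n where "n = sqrt (Re (I r r))"
      have rr: "I r r = complex_of_real n * complex_of_real n"
        using cinner_self[OF assms, of r] by (simp add: n_def flip: of_real_mult)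
      have n: "n \<noteq> 0" using rr cinner_eq_0[OF assms, of r] False by auto
      define e where "e = complex_of_real (1 / n) *\<^sub>C r"
      have ee: "I e e = 1" using n by (simp add: e_def ip(2,4) rr)
      have eb: "I b e = 0" "I e b = 0" if "b \<in> B" for b
      proof -
        show "I b e = 0" using orth[OF that] by (simp add: e_def ip)
        then show "I e b = 0" using cinner_commute[OF assms, of e b] by simp
      qed
      have eB: "e \<notin> B" using ee eb by force
      define Q where "Q x = (\<Sum>b\<in>insert e B. I b x *\<^sub>C b)" for x
      have Q: "Q x = I e x *\<^sub>C e + P x" for x
        using eB B(1) by (simp add: Q_def P_def)
      have Q_lin: "Q (x + y) = Q x + Q y" "Q (c *\<^sub>C x) = c *\<^sub>C Q x" for x y c
        by (simp_all add: Q ip P_lin scaleC_add_left scaleC_add_right scaleC_scaleC)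
      have QB: "Q b = b" if "b \<in> B" for b
      proof -
        have "P b = (\<Sum>c\<in>B. if c = b then b else 0)"
          unfolding P_def using B(2) that by (intro sum.cong) (auto simp: scaleC_one)
        then show ?thesis using that B(1) eb[OF that] by (simp add: Q)
      qed
      have Qe: "Q e = e"
        using eb ee by (simp add: Q P_def scaleC_one)
      have r_e: "r = complex_of_real n *\<^sub>C e"
        using n by (simp add: e_def scaleC_scaleC scaleC_one)
      have Qr: "Q r = r" unfolding r_e by (simp add: Q_lin Qe)
      have Q0: "Q 0 = 0" using Q_lin(2)[of 0 0] by simp
      have Q_sum: "Q (\<Sum>i\<in>A. f i) = (\<Sum>i\<in>A. Q (f i))" for A :: "'a set" and f
        by (induction A rule: infinite_finite_induct) (auto simp: Q0 Q_lin)
      have QP: "Q (P x) = P x" for x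
        unfolding P_def Q_sum by (intro sum.cong) (auto simp: Q_lin QB)
      have "s = r + P s" by (simp add: r_def)
      then have Qs: "Q s = s" by (metis Q_lin(1) Qr QP)
      have "x = Q x" if "x \<in> complex_vector.span (insert s S)" for x
        using that
      proof (induction rule: complex_vector.span_induct_alt)
        case base
        then show ?case by (simp add: Q0)
      next
        case (step c x y)
        have "x = Q x"
        proof (cases "x = s")
          case False
          then have "x \<in> complex_vector.span S"
            using step(1) by (simp add: complex_vector.span_base)
          then have "x = P x" using B(3) by (simp add: P_def)
          then show ?thesis using QP by metis
        qed (simp add: Qs)
        then show ?case using step by (simp add: Q_lin)
      qed
      then show ?thesis
        using B(1,2) ee eb eB by (intro exI[of _ "insert e B"]) (auto simp: Q_def[symmetric])
    qed
  qed
  then show ?thesis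
    unfolding orthonormal_basis_def S(2) by blast
qed

lemma is_cinner_scalar: "is_cinner scalar_inner"
  unfolding is_cinner_def
proof (intro conjI allI impI)
  fix x :: complex
  show "clinear (scalar_inner x)"
    by (rule clinearI) (simp_all add: scalar_inner_def scaleC_complex_mult algebra_simps)
  have "scalar_inner x x = of_real ((cmod x)\<^sup>2)"
    by (metis complex_norm_square mult.commute scalar_inner_def)
  then show "scalar_inner x x \<in> \<real>\<^sub>\<ge>\<^sub>0"
    by (simp only: nonneg_Reals_of_real_iff) simp
  show "x = 0" if "scalar_inner x x = 0" using that by (simp add: scalar_inner_def)
  show "scalar_inner y x = cnj (scalar_inner x y)" for y by (simp add: scalar_inner_def)
qed

lemma tensor_inner_sesquilinear:
  assumes "is_cinner I" "is_cinner J"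
  shows "tensor_inner I J (x \<otimes>\<^sub>v y) (x' \<otimes>\<^sub>v y') = I x x' * J y y'"
    "tensor_inner I J s (t + t') = tensor_inner I J s t + tensor_inner I J s t'"
    "tensor_inner I J s (c *\<^sub>C t) = c * tensor_inner I J s t"
    "tensor_inner I J (s + s') t = tensor_inner I J s t + tensor_inner I J s' t"
    "tensor_inner I J (c *\<^sub>C s) t = cnj c * tensor_inner I J s t"
proof -
  note ip = cinner_simps[OF assms(1)] cinner_simps[OF assms(2)]
  have b1: "cbilinear (\<lambda>x' y'. I x x' * J y y')" for x y
    by (simp add: cbilinear_def clinear_iff ip scaleC_complex_mult algebra_simps)
  note L1 = clinear_tensor_lift[OF b1] and V1 = tensor_lift_vec[OF b1]
  define G where "G x y t = tensor_lift (\<lambda>x' y'. I x x' * J y y') t" for x y t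
  have Gl: "G x y (s + t) = G x y s + G x y t" "G x y (c *\<^sub>C t) = c * G x y t" for x y s t c
    using L1 by (simp_all add: G_def clinear_iff scaleC_complex_mult)
  have Gv: "G x y (x' \<otimes>\<^sub>v y') = I x x' * J y y'" for x y x' y'
    by (simp add: G_def V1)
  have Gb: "G (x + x') y t = G x y t + G x' y t" "G x (y + y') t = G x y t + G x y' t"
    "G (c *\<^sub>C x) y t = cnj c * G x y t" "G x (c *\<^sub>C y) t = cnj c * G x y t" for x x' y y' c t
    by (induction t rule: tensor_induct; simp add: Gl Gv ip; simp add: algebra_simps)+
  have b2: "cbilinear (\<lambda>x y. cnj (G x y t))" for t
    by (simp add: cbilinear_def clinear_iff Gb scaleC_complex_mult)
  have T: "tensor_inner I J s t = cnj (tensor_lift (\<lambda>x y. cnj (G x y t)) s)" for s t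
    by (simp add: tensor_inner_def G_def)
  note L2 = clinear_tensor_lift[OF b2] and V2 = tensor_lift_vec[OF b2]
  show "tensor_inner I J (x \<otimes>\<^sub>v y) (x' \<otimes>\<^sub>v y') = I x x' * J y y'"
    unfolding T V2 unfolding Gv by simp
  show left: "tensor_inner I J (s + s') t = tensor_inner I J s t + tensor_inner I J s' t"
    "tensor_inner I J (c *\<^sub>C s) t = cnj c * tensor_inner I J s t" for s s' t c
    using L2[of t] by (simp_all add: T clinear_iff scaleC_complex_mult)
  have vec: "tensor_inner I J (x \<otimes>\<^sub>v y) t = G x y t" for x y t
    unfolding T V2 by simp
  show "tensor_inner I J s (t + t') = tensor_inner I J s t + tensor_inner I J s t'"
    by (induction s rule: tensor_induct) (simp_all add: left vec Gl)
  show "tensor_inner I J s (c *\<^sub>C t) = c * tensor_inner I J s t"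
    by (induction s rule: tensor_induct) (simp_all add: left vec Gl algebra_simps)
qed

lemma is_cinner_tensor:
  fixes I :: "'a::fd_complex_vector cinner" and J :: "'b::complex_vector cinner"
  assumes "is_cinner I" "is_cinner J"
  shows "is_cinner (tensor_inner I J)"
proof -
  note ip = cinner_simps[OF assms(1)] and jp = cinner_simps[OF assms(2)]
  let ?T = "tensor_inner I J"
  note T = tensor_inner_sesquilinear[OF assms]
  obtain B where B: "orthonormal_basis I B"
    using orthonormal_basis_exists[OF assms(1)] by blast
  have tl: "clinear (\<lambda>x. x \<otimes>\<^sub>v y)" for y :: 'b
    by (rule clinearI) (simp_all add: tensor_vec_simps)
  have lT: "clinear (?T s)" for s
    by (rule clinearI) (simp_all add: T scaleC_complex_mult)
  have sym: "?T t s = cnj (?T s t)" for s t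
  proof (induction s arbitrary: t rule: tensor_induct)
    case (vec x y)
    show ?case
    proof (induction t rule: tensor_induct)
      case (vec x' y')
      then show ?case using cinner_commute[OF assms(1), of x' x] cinner_commute[OF assms(2), of y' y] by (simp add: T)
    qed (simp add: T)
  qed (simp add: T)
  have pos: "?T t t \<in> \<real>\<^sub>\<ge>\<^sub>0 \<and> (?T t t = 0 \<longrightarrow> t = 0)" for t
  proof -
    have "\<exists>u. t = (\<Sum>b\<in>B. b \<otimes>\<^sub>v u b)"
    proof (induction t rule: tensor_induct)
      case (vec x y)
      have "x = (\<Sum>b\<in>B. I b x *\<^sub>C b)" using B by (auto simp: orthonormal_basis_def)
      then have "x \<otimes>\<^sub>v y = (\<Sum>b\<in>B. I b x *\<^sub>C b) \<otimes>\<^sub>v y" by simp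
      also have "\<dots> = (\<Sum>b\<in>B. b \<otimes>\<^sub>v (I b x *\<^sub>C y))"
        by (simp add: clinear_sum[OF tl] tensor_vec_simps)
      finally show ?case by (intro exI[of _ "\<lambda>b. I b x *\<^sub>C y"])
    next
      case (add s t)
      then obtain u v where "s = (\<Sum>b\<in>B. b \<otimes>\<^sub>v u b)" "t = (\<Sum>b\<in>B. b \<otimes>\<^sub>v v b)" by blast
      then show ?case
        by (intro exI[of _ "\<lambda>b. u b + v b"]) (simp add: tensor_vec_simps sum.distrib)
    qed
    then obtain u where t: "t = (\<Sum>b\<in>B. b \<otimes>\<^sub>v u b)" by blast
    have fB: "finite B" using B by (simp add: orthonormal_basis_def)
    have "?T t (b \<otimes>\<^sub>v u b) = J (u b) (u b)" if "b \<in> B" for b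
    proof -
      have "?T (b \<otimes>\<^sub>v u b) t = (\<Sum>c\<in>B. I b c * J (u b) (u c))"
        unfolding t clinear_sum[OF lT] by (simp add: T)
      also have "\<dots> = (\<Sum>c\<in>B. if b = c then J (u b) (u b) else 0)"
        using B that by (intro sum.cong) (auto simp: orthonormal_basis_def)
      also have "\<dots> = J (u b) (u b)" using fB that by simp
      finally have "?T t (b \<otimes>\<^sub>v u b) = cnj (J (u b) (u b))" using sym[of t "b \<otimes>\<^sub>v u b"] by simp
      then show ?thesis using cinner_commute[OF assms(2), of "u b" "u b"] by simp
    qed
    then have "?T t t = (\<Sum>b\<in>B. J (u b) (u b))"
      by (subst (2) t) (simp add: clinear_sum[OF lT])
    then have e: "?T t t = complex_of_real (\<Sum>b\<in>B. Re (J (u b) (u b)))"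
      unfolding of_real_sum using cinner_self(1)[OF assms(2)] by (metis (no_types, lifting) sum.cong)
    have "t = 0" if "?T t t = 0"
    proof -
      have "(\<Sum>b\<in>B. Re (J (u b) (u b))) = 0" using that unfolding e of_real_eq_0_iff .
      then have "\<forall>b\<in>B. Re (J (u b) (u b)) = 0"
        using fB cinner_self(2)[OF assms(2)] by (simp add: sum_nonneg_eq_0_iff)
      then have "\<forall>b\<in>B. u b = 0" by (metis cinner_self(1)[OF assms(2)] cinner_eq_0[OF assms(2)] of_real_0)
      moreover have "b \<otimes>\<^sub>v (0::'b) = 0" for b :: 'a
        using tensor_vec_simps(4)[of b 0 "0::'b"] by simp
      ultimately show ?thesis by (simp add: t)
    qed
    moreover have "?T t t \<in> \<real>\<^sub>\<ge>\<^sub>0"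
      unfolding e nonneg_Reals_of_real_iff using cinner_self(2)[OF assms(2)] by (intro sum_nonneg) auto
    ultimately show ?thesis by blast
  qed
  show ?thesis
    unfolding is_cinner_def using lT sym pos by blast
qed

lemma riesz:
  fixes I :: "'a::fd_complex_vector cinner"
  assumes "is_cinner I" "clinear \<phi>"
  shows "\<exists>!u. \<forall>x. I u x = \<phi> x"
proof -
  obtain B where B: "orthonormal_basis I B"
    using orthonormal_basis_exists[OF assms(1)] by blast
  note ip = cinner_simps[OF assms(1)]
  let ?u = "\<Sum>b\<in>B. cnj (\<phi> b) *\<^sub>C b"
  have "I ?u x = \<phi> x" for x
  proof -
    have x: "x = (\<Sum>b\<in>B. I b x *\<^sub>C b)" using B by (auto simp: orthonormal_basis_def)
    have "I ?u x = (\<Sum>b\<in>B. \<phi> b * I b x)"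
      by (simp add: cinner_sum_left[OF assms(1)] ip)
    also have "\<dots> = \<phi> (\<Sum>b\<in>B. I b x *\<^sub>C b)"
      by (simp add: clinear_sum[OF assms(2)] clinear_scale[OF assms(2)] scaleC_complex_mult mult.commute)
    finally show ?thesis using x by simp
  qed
  moreover have "u = v" if "\<forall>x. I u x = \<phi> x" "\<forall>x. I v x = \<phi> x" for u v
    by (rule cinner_eqI[OF assms(1)]) (metis that cinner_commute[OF assms(1)])
  ultimately show ?thesis by blast
qed

lemma adjoint_unique_exists:
  fixes I :: "'a::fd_complex_vector cinner" and J :: "'b::complex_vector cinner"
  assumes "is_cinner I" "is_cinner J" "clinear f"
  shows "\<exists>!g. \<forall>x y. J (f x) y = I x (g y)"
proof -
  note ip = cinner_simps[OF assms(1)] and jp = cinner_simps[OF assms(2)]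
  have "clinear (\<lambda>x. J y (f x))" for y
    using assms(3) by (simp add: clinear_iff jp scaleC_complex_mult)
  then have "\<exists>u. \<forall>x. I u x = J y (f x)" for y
    using riesz[OF assms(1)] by blast
  then obtain g where "\<And>x y. I (g y) x = J y (f x)" by metis
  then have g: "\<forall>x y. J (f x) y = I x (g y)"
    by (subst cinner_commute[OF assms(1)], subst cinner_commute[OF assms(2)]) simp
  show ?thesis
  proof (rule ex1I[of _ g])
    show "\<forall>x y. J (f x) y = I x (g y)" by (fact g)
    show "h = g" if "\<forall>x y. J (f x) y = I x (h y)" for h
      by (rule ext, rule cinner_eqI[OF assms(1)]) (simp add: that[rule_format, symmetric] g[rule_format, symmetric])
  qed
qed

lemma adjoint_eq:
  fixes I :: "'a::fd_complex_vector cinner" and J :: "'b::complex_vector cinner"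
  assumes "is_cinner I" "is_cinner J" "clinear f"
  shows "J (f x) y = I x (adjoint I J f y)"
  using theI'[OF adjoint_unique_exists[OF assms]] unfolding adjoint_def by blast

lemma clinear_adjoint:
  fixes I :: "'a::fd_complex_vector cinner" and J :: "'b::complex_vector cinner"
  assumes "is_cinner I" "is_cinner J" "clinear f"
  shows "clinear (adjoint I J f)"
proof (rule clinearI)
  note ip = cinner_simps[OF assms(1)] and jp = cinner_simps[OF assms(2)]
  note a = adjoint_eq[OF assms, symmetric]
  show "adjoint I J f (x + y) = adjoint I J f x + adjoint I J f y" for x y
    by (rule cinner_eqI[OF assms(1)]) (simp only: ip jp a)
  show "adjoint I J f (c *\<^sub>C x) = c *\<^sub>C adjoint I J f x" for c x
    by (rule cinner_eqI[OF assms(1)]) (simp only: ip jp a)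
qed

section \<open>Normalized C*-Frobenius algebras\<close>

text \<open>The objects \<open>(X, m, \<iota>)\<close> on a given vector space; the Hilbert space structure \<open>fip\<close> belongs
  to the data.  As \<open>\<otimes>\<close> is not strict, the associator and the unitors are written out in the axioms.\<close>

record (overloaded) 'a frobenius =
  fip :: "'a cinner"
  fmult :: "('a, 'a) tensor \<Rightarrow> 'a"
  funit :: "complex \<Rightarrow> 'a"

definition fmult_adj :: "'a::complex_vector frobenius \<Rightarrow> 'a \<Rightarrow> ('a, 'a) tensor" where
  "fmult_adj X = adjoint (tensor_inner (fip X) (fip X)) (fip X) (fmult X)"

definition funit_adj :: "'a::complex_vector frobenius \<Rightarrow> 'a \<Rightarrow> complex" where
  "funit_adj X = adjoint scalar_inner (fip X) (funit X)"

definition normalized_cstar_frobenius :: "'a::fd_complex_vector frobenius \<Rightarrow> bool" where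
  "normalized_cstar_frobenius X \<longleftrightarrow>
     (let m = fmult X; m' = fmult_adj X; i = funit X; i' = funit_adj X in
        is_cinner (fip X) \<and> clinear m \<and> clinear i \<and>
        m \<circ> (m \<otimes>\<^sub>l id) = m \<circ> (id \<otimes>\<^sub>l m) \<circ> associator \<and>
        m \<circ> (i \<otimes>\<^sub>l id) = left_unitor \<and> m \<circ> (id \<otimes>\<^sub>l i) = right_unitor \<and>
        (m \<otimes>\<^sub>l id) \<circ> associator_inv \<circ> (id \<otimes>\<^sub>l m') = m' \<circ> m \<and>
        m' \<circ> m = (id \<otimes>\<^sub>l m) \<circ> associator \<circ> (m' \<otimes>\<^sub>l id) \<and>
        i' \<circ> i = id)"

text \<open>The antilinear map \<open>S\<close> with \<open>\<iota>\<^sup>*(m(v \<otimes> w)) = \<langle>S v, w\<rangle>\<close>; it exists by Riesz.\<close>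

definition frobenius_S :: "'a::complex_vector frobenius \<Rightarrow> 'a \<Rightarrow> 'a" where
  "frobenius_S X v = (THE u. \<forall>w. fip X u w = funit_adj X (fmult X (v \<otimes>\<^sub>v w)))"

section \<open>Finite-dimensional C*-algebras with faithful states\<close>

record 'a cstar =
  cmult :: "'a \<Rightarrow> 'a \<Rightarrow> 'a"
  cone :: 'a
  cstar :: "'a \<Rightarrow> 'a"
  cnorm :: "'a \<Rightarrow> real"

text \<open>Completeness in the norm is automatic in finite dimension.\<close>

definition cstar_algebra :: "'a::fd_complex_vector cstar \<Rightarrow> bool" where
  "cstar_algebra A \<longleftrightarrow>
     cbilinear (cmult A) \<and>
     (\<forall>x y z. cmult A (cmult A x y) z = cmult A x (cmult A y z)) \<and>
     (\<forall>x. cmult A (cone A) x = x \<and> cmult A x (cone A) = x) \<and>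
     antilinear (cstar A) \<and>
     (\<forall>x. cstar A (cstar A x) = x) \<and>
     (\<forall>x y. cstar A (cmult A x y) = cmult A (cstar A y) (cstar A x)) \<and>
     (\<forall>x. 0 \<le> cnorm A x) \<and> (\<forall>x. cnorm A x = 0 \<longleftrightarrow> x = 0) \<and>
     (\<forall>x y. cnorm A (x + y) \<le> cnorm A x + cnorm A y) \<and>
     (\<forall>c x. cnorm A (c *\<^sub>C x) = cmod c * cnorm A x) \<and>
     (\<forall>x y. cnorm A (cmult A x y) \<le> cnorm A x * cnorm A y) \<and>
     (\<forall>x. cnorm A (cmult A (cstar A x) x) = (cnorm A x)\<^sup>2)"

definition faithful_state :: "'a::fd_complex_vector cstar \<Rightarrow> ('a \<Rightarrow> complex) \<Rightarrow> bool" where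
  "faithful_state A \<omega> \<longleftrightarrow> clinear \<omega> \<and> (\<forall>x. \<omega> (cmult A (cstar A x) x) \<in> \<real>\<^sub>\<ge>\<^sub>0) \<and> \<omega> (cone A) = 1 \<and>
     (\<forall>x. \<omega> (cmult A (cstar A x) x) = 0 \<longrightarrow> x = 0)"

text \<open>The GNS Hilbert space is \<open>A\<close> itself, with the representation by left multiplication and the
  cyclic and separating vector \<open>\<Omega> = 1\<close>.  The state enters through the inner product only; the map
  \<open>x \<Omega> \<mapsto> x\<^sup>\<dagger> \<Omega>\<close> itself does not depend on it.\<close>

definition gns_inner :: "'a cstar \<Rightarrow> ('a \<Rightarrow> complex) \<Rightarrow> 'a cinner" where
  "gns_inner A \<omega> x y = \<omega> (cmult A (cstar A x) y)"

definition gns_rep :: "'a cstar \<Rightarrow> 'a \<Rightarrow> 'a \<Rightarrow> 'a" where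
  "gns_rep A x v = cmult A x v"

definition gns_vector :: "'a cstar \<Rightarrow> 'a" where
  "gns_vector A = cone A"

definition tomita_operator :: "'a cstar \<Rightarrow> 'a \<Rightarrow> 'a" where
  "tomita_operator A =
     (THE T. \<forall>x. T (gns_rep A x (gns_vector A)) = gns_rep A (cstar A x) (gns_vector A))"

lemma tomita_operator_eq: "cstar_algebra A \<Longrightarrow> tomita_operator A = cstar A"
  unfolding tomita_operator_def gns_rep_def gns_vector_def cstar_algebra_def
  by (rule the_equality) auto

end

theory Submission
  imports Defs
begin

text \<open>Write \<open>L\<^sub>x\<close> and \<open>R\<^sub>y\<close> for left and right multiplication.  Tested against \<open>a \<otimes> b\<close>, the two
  Frobenius identities say that \<open>L\<^sub>x\<^sup>*(a b) = L\<^sub>x\<^sup>*(a) b\<close> and \<open>R\<^sub>y\<^sup>*(a b) = a R\<^sub>y\<^sup>*(b)\<close>.  The first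
  one means that \<open>L\<^sub>x\<^sup>*\<close> is left multiplication by \<open>L\<^sub>x\<^sup>*(1) = S x\<close>, so that \<open>X\<close> is an algebra with
  involution \<open>S\<close>, represented on itself by left multiplication, and \<open>\<langle>x, y\<rangle> = \<omega>(S(x) y)\<close> for
  \<open>\<omega> = \<langle>1, -\<rangle>\<close>.  The operator norm of \<open>L\<^sub>x\<close> is a C*-norm.  Conversely, the first identity holds in
  the GNS space because the adjoint of \<open>L\<^sub>x\<close> is left multiplication by \<open>x\<^sup>\<dagger>\<close>, and the second one
  because left multiplications are closed under adjoints, so that \<open>R\<^sub>y\<^sup>*\<close> commutes with them as
  \<open>R\<^sub>y\<close> does.  That every pair \<open>(A, \<omega>)\<close> arises, with its given norm, uses that the C*-norm is
  determined by the algebra and its involution.\<close>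

section \<open>Positive forms and operator norms\<close>

locale positive_form =
  fixes F :: "'a::complex_vector cinner"
  assumes linear_right: "clinear (F x)"
    and hermitian: "F y x = cnj (F x y)"
    and nonneg: "0 \<le> Re (F x x)"
begin

lemma form_simps:
  "F x (y + z) = F x y + F x z" "F x (c *\<^sub>C y) = c * F x y"
  "F (x + y) z = F x z + F y z" "F (c *\<^sub>C x) y = cnj c * F x y"
proof -
  show right: "F x (y + z) = F x y + F x z" "F x (c *\<^sub>C y) = c * F x y" for x y z c
    using linear_right[of x] by (simp_all add: clinear_iff scaleC_complex_mult)
  show "F (x + y) z = F x z + F y z"
    using hermitian[of "x + y" z] hermitian[of x z] hermitian[of y z] by (simp add: right)
  show "F (c *\<^sub>C x) y = cnj c * F x y"
    using hermitian[of "c *\<^sub>C x" y] hermitian[of x y] by (simp add: right)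
qed

text \<open>Stated for semidefinite forms because \<open>opnorm_attained\<close> applies it to the
  form of \<open>N\<^sup>2 - f\<^sup>* f\<close>, for which only nonnegativity is at hand.\<close>

lemma cauchy_schwarz: "(cmod (F x y))\<^sup>2 \<le> Re (F x x) * Re (F y y)"
proof -
  define p where "p = (cmod (F x y))\<^sup>2"
  have p: "cnj (F x y) * F x y = of_real p"
    by (metis complex_norm_square mult.commute p_def)
  \<comment> \<open>The value of the form at \<open>x - s F(y, x) y\<close>: this coefficient
    cancels the phase of \<open>F x y\<close> and leaves a real quadratic polynomial in
    \<open>s\<close>.\<close>
  have quad: "0 \<le> Re (F x x) - 2 * s * p + s\<^sup>2 * p * Re (F y y)" for s :: real
  proof -
    let ?c = "- (of_real s * cnj (F x y))"
    have "F (x + ?c *\<^sub>C y) (x + ?c *\<^sub>C y) =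
        F x x - of_real s * (cnj (F x y) * F x y) - of_real s * (cnj (F x y) * F x y)
          + of_real s * of_real s * (cnj (F x y) * F x y) * F y y"
      unfolding form_simps hermitian[of y x] by (simp add: algebra_simps)
    also have "\<dots> = F x x - of_real (2 * s * p) + of_real (s\<^sup>2 * p) * F y y"
      by (simp add: p power2_eq_square)
    finally show ?thesis
      using nonneg[of "x + ?c *\<^sub>C y"] by simp
  qed
  show ?thesis
  \<comment> \<open>If \<open>F y y\<close> has real part 0, the polynomial is affine and a large
    \<open>s\<close> would make it negative unless \<open>p = 0\<close>; otherwise
    \<open>s = 1 / Re (F y y)\<close> is its minimizer.\<close>
  proof (cases "Re (F y y) = 0")
    case True
    have "p = 0"
    proof (rule ccontr)
      assume "p \<noteq> 0"
      then have "2 * ((Re (F x x) + 1) / p) * p = 2 * (Re (F x x) + 1)" by simp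
      with quad[of "(Re (F x x) + 1) / p"] True nonneg[of x] show False by simp
    qed
    then show ?thesis by (simp add: True p_def)
  next
    case False
    then have pos: "Re (F y y) > 0" using nonneg[of y] by simp
    have "0 \<le> Re (F x x) - p / Re (F y y)"
      using quad[of "1 / Re (F y y)"] False by (simp add: power2_eq_square)
    then show ?thesis using pos by (simp add: field_simps p_def)
  qed
qed

end

lemma positive_form_cinner: "is_cinner I \<Longrightarrow> positive_form I"
  by (rule positive_form.intro) (erule clinear_cinner cinner_commute cinner_self(2))+

text \<open>Polarization: the diagonal at \<open>x + y\<close> compares the imaginary parts of
  \<open>G x y\<close> and \<open>G y x\<close>, the one at \<open>x + \<i> y\<close> their real
  parts. A state is only assumed positive, so the symmetry of the GNS form is obtained this
  way.\<close>

lemma hermitian_of_real_diagonal: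
  fixes G :: "'a::complex_vector cinner"
  assumes right: "\<And>x y z. G x (y + z) = G x y + G x z" "\<And>x y c. G x (c *\<^sub>C y) = c * G x y"
    and left: "\<And>x y z. G (x + y) z = G x z + G y z" "\<And>x y c. G (c *\<^sub>C x) y = cnj c * G x y"
    and real: "\<And>x. Im (G x x) = 0"
  shows "G y x = cnj (G x y)"
proof -
  have "Im (G (x + y) (x + y)) = 0" "Im (G (x + \<i> *\<^sub>C y) (x + \<i> *\<^sub>C y)) = 0"
    by (rule real)+
  then show ?thesis
    using real[of x] real[of y] by (simp add: right left complex_eq_iff)
qed

section \<open>The norm of an inner product\<close>

definition inorm :: "'a::complex_vector cinner \<Rightarrow> 'a \<Rightarrow> real" where
  "inorm I x = sqrt (Re (I x x))"

lemma inorm_nonneg: "is_cinner I \<Longrightarrow> 0 \<le> inorm I x"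
  by (simp add: inorm_def cinner_self(2))

lemma inorm_square: "is_cinner I \<Longrightarrow> (inorm I x)\<^sup>2 = Re (I x x)"
  by (simp add: inorm_def cinner_self(2))

lemma inorm_eq_0:
  assumes "is_cinner I"
  shows "inorm I x = 0 \<longleftrightarrow> x = 0"
proof
  assume "inorm I x = 0"
  then have "Re (I x x) = 0" by (simp add: inorm_def)
  then have "I x x = 0" using cinner_self(1)[OF assms, of x] by simp
  then show "x = 0" by (rule cinner_eq_0[OF assms])
next
  have "I x 0 = 0" by (rule clinear_0[OF clinear_cinner[OF assms]])
  then show "x = 0 \<Longrightarrow> inorm I x = 0"
    using clinear_0[OF clinear_cinner[OF assms]] by (simp add: inorm_def)
qed

lemma inorm_scale: "is_cinner I \<Longrightarrow> inorm I (c *\<^sub>C x) = cmod c * inorm I x"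
proof -
  assume I: "is_cinner I"
  have "I (c *\<^sub>C x) (c *\<^sub>C x) = of_real ((cmod c)\<^sup>2) * I x x"
    by (simp only: cinner_simps[OF I] complex_norm_square) (simp add: ac_simps)
  then have "Re (I (c *\<^sub>C x) (c *\<^sub>C x)) = (cmod c)\<^sup>2 * Re (I x x)"
    by (metis Re_complex_of_real cinner_self(1)[OF I] of_real_mult)
  then show ?thesis by (simp add: inorm_def real_sqrt_mult)
qed

lemma inorm_cauchy_schwarz:
  assumes "is_cinner I"
  shows "cmod (I x y) \<le> inorm I x * inorm I y"
proof (rule power2_le_imp_le)
  show "(cmod (I x y))\<^sup>2 \<le> (inorm I x * inorm I y)\<^sup>2"
    using positive_form.cauchy_schwarz[OF positive_form_cinner[OF assms], of x y]
    by (simp add: power_mult_distrib inorm_square assms)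
qed (simp add: inorm_nonneg assms)

lemma inorm_triangle:
  assumes "is_cinner I"
  shows "inorm I (x + y) \<le> inorm I x + inorm I y"
proof (rule power2_le_imp_le)
  have "Re (I x y) \<le> inorm I x * inorm I y" "Re (I y x) \<le> inorm I y * inorm I x"
    using inorm_cauchy_schwarz[OF assms] complex_Re_le_cmod order_trans by blast+
  then show "(inorm I (x + y))\<^sup>2 \<le> (inorm I x + inorm I y)\<^sup>2"
    by (simp add: inorm_square[OF assms] cinner_simps[OF assms] power2_sum algebra_simps)
qed (simp add: inorm_nonneg assms)

text \<open>Expand in an orthonormal basis: Cauchy-Schwarz bounds each coefficient by the norm of
  the vector, so the sum of \<open>q\<close> over the basis serves as \<open>C\<close>. It gives
  both the boundedness of linear maps and the comparison of a C*-norm with the Hilbert norm.\<close>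

lemma seminorm_bounded:
  fixes I :: "'a::fd_complex_vector cinner" and q :: "'a \<Rightarrow> real"
  assumes I: "is_cinner I" and nonneg: "\<And>x. 0 \<le> q x"
    and add: "\<And>x y. q (x + y) \<le> q x + q y" and scale: "\<And>c x. q (c *\<^sub>C x) = cmod c * q x"
  obtains C where "0 \<le> C" "\<And>x. q x \<le> C * inorm I x"
proof -
  obtain B where B: "orthonormal_basis I B" using orthonormal_basis_exists[OF I] by blast
  have q_sum: "q (\<Sum>b\<in>B. f b) \<le> (\<Sum>b\<in>B. q (f b))" for f
  proof (induction B rule: infinite_finite_induct)
    case (insert b B)
    then show ?case using add[of "f b" "\<Sum>b\<in>B. f b"] by simp
  qed (use scale[of 0 0] in auto)
  have unit: "inorm I b = 1" if "b \<in> B" for b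
    using B that by (simp add: inorm_def orthonormal_basis_def)
  have "q x \<le> (\<Sum>b\<in>B. q b) * inorm I x" for x
  proof -
    have "x = (\<Sum>b\<in>B. I b x *\<^sub>C b)" using B by (auto simp: orthonormal_basis_def)
    then have "q x \<le> (\<Sum>b\<in>B. q (I b x *\<^sub>C b))" using q_sum by metis
    also have "\<dots> \<le> (\<Sum>b\<in>B. q b * inorm I x)"
    proof (rule sum_mono)
      fix b assume "b \<in> B"
      then have "cmod (I b x) \<le> inorm I x"
        using inorm_cauchy_schwarz[OF I, of b x] by (simp add: unit)
      then show "q (I b x *\<^sub>C b) \<le> q b * inorm I x"
        by (simp add: scale mult.commute mult_left_mono nonneg)
    qed
    finally show ?thesis by (simp add: sum_distrib_right)
  qed
  then show thesis by (intro that[of "\<Sum>b\<in>B. q b"]) (simp_all add: sum_nonneg nonneg)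
qed

section \<open>Bounded operators and the operator norm\<close>

lemma clinear_bounded:
  fixes I :: "'a::fd_complex_vector cinner"
  assumes "is_cinner I" "clinear f"
  obtains C where "0 \<le> C" "\<And>x. inorm I (f x) \<le> C * inorm I x"
proof (rule seminorm_bounded[OF assms(1), of "\<lambda>x. inorm I (f x)"])
  show "0 \<le> inorm I (f x)" "inorm I (f (x + y)) \<le> inorm I (f x) + inorm I (f y)"
    "inorm I (f (c *\<^sub>C x)) = cmod c * inorm I (f x)" for x y c
    by (simp_all add: assms(1) clinear_add[OF assms(2)] clinear_scale[OF assms(2)] inorm_nonneg
        inorm_triangle inorm_scale)
qed (rule that)

text \<open>An infimum of bounds instead of a supremum of quotients: upper estimates are then
  immediate. The condition \<open>0 \<le> c\<close> keeps the set bounded below on the zero space as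
  well.\<close>

definition opnorm :: "'a::complex_vector cinner \<Rightarrow> ('a \<Rightarrow> 'a) \<Rightarrow> real" where
  "opnorm I f = Inf {c. 0 \<le> c \<and> (\<forall>x. inorm I (f x) \<le> c * inorm I x)}"

lemma opnorm_le:
  assumes "0 \<le> c" "\<And>x. inorm I (f x) \<le> c * inorm I x"
  shows "opnorm I f \<le> c"
  unfolding opnorm_def by (rule cInf_lower) (use assms in \<open>auto intro: bdd_belowI[of _ 0]\<close>)

context
  fixes I :: "'a::fd_complex_vector cinner" and f :: "'a \<Rightarrow> 'a"
  assumes I: "is_cinner I" and f: "clinear f"
begin

lemma opnorm_nonneg: "0 \<le> opnorm I f"
proof -
  obtain C where "0 \<le> C" "\<And>x. inorm I (f x) \<le> C * inorm I x"
    by (rule clinear_bounded[OF I f], rule that)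
  then show ?thesis unfolding opnorm_def by (intro cInf_greatest) auto
qed

lemma opnorm_bound: "inorm I (f x) \<le> opnorm I f * inorm I x"
proof (cases "x = 0")
  case True
  moreover have "inorm I (0 :: 'a) = 0" by (simp add: inorm_eq_0[OF I])
  ultimately show ?thesis using clinear_0[OF f] by simp
next
  case False
  then have pos: "0 < inorm I x"
    using inorm_nonneg[OF I, of x] inorm_eq_0[OF I, of x] by linarith
  obtain C where "0 \<le> C" "\<And>x. inorm I (f x) \<le> C * inorm I x" 
    by (rule clinear_bounded[OF I f], rule that)
  \<comment> \<open>Each admissible constant dominates this quotient, hence so does their infimum;
    \<open>C\<close> shows that there is an admissible constant at all.\<close>
  then have "inorm I (f x) / inorm I x \<le> opnorm I f"
    unfolding opnorm_def by (intro cInf_greatest) (use pos in \<open>auto simp: field_simps\<close>)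
  then show ?thesis using pos by (simp add: field_simps)
qed

lemma opnorm_eq_0: "opnorm I f = 0 \<longleftrightarrow> (\<forall>x. f x = 0)"
proof
  assume "opnorm I f = 0"
  then have "inorm I (f x) = 0" for x using opnorm_bound[of x] inorm_nonneg[OF I, of "f x"] by simp
  then show "\<forall>x. f x = 0" by (simp add: inorm_eq_0[OF I])
next
  assume "\<forall>x. f x = 0"
  moreover have "inorm I (0 :: 'a) = 0" by (simp add: inorm_eq_0[OF I])
  ultimately have "opnorm I f \<le> 0" by (intro opnorm_le) auto
  then show "opnorm I f = 0" using opnorm_nonneg by linarith
qed

end

lemma opnorm_add_le:
  fixes I :: "'a::fd_complex_vector cinner"
  assumes "is_cinner I" "clinear f" "clinear g"
  shows "opnorm I (\<lambda>x. f x + g x) \<le> opnorm I f + opnorm I g"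
proof (rule opnorm_le)
  fix x
  have "inorm I (f x + g x) \<le> inorm I (f x) + inorm I (g x)" by (rule inorm_triangle[OF assms(1)])
  then show "inorm I (f x + g x) \<le> (opnorm I f + opnorm I g) * inorm I x"
    using opnorm_bound[OF assms(1,2), of x] opnorm_bound[OF assms(1,3), of x]
    by (simp add: distrib_right)
qed (simp add: opnorm_nonneg assms)

lemma opnorm_compose_le:
  fixes I :: "'a::fd_complex_vector cinner"
  assumes "is_cinner I" "clinear f" "clinear g"
  shows "opnorm I (\<lambda>x. f (g x)) \<le> opnorm I f * opnorm I g"
proof (rule opnorm_le)
  fix x
  have "inorm I (f (g x)) \<le> opnorm I f * inorm I (g x)" by (rule opnorm_bound[OF assms(1,2)])
  also have "\<dots> \<le> opnorm I f * (opnorm I g * inorm I x)"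
    by (intro mult_left_mono opnorm_bound opnorm_nonneg assms)
  finally show "inorm I (f (g x)) \<le> opnorm I f * opnorm I g * inorm I x" by (simp add: mult.assoc)
qed (simp add: opnorm_nonneg assms)

lemma opnorm_scale:
  fixes I :: "'a::fd_complex_vector cinner"
  assumes I: "is_cinner I" and f: "clinear f"
  shows "opnorm I (\<lambda>x. c *\<^sub>C f x) = cmod c * opnorm I f"
proof (cases "c = 0")
  case True
  have "clinear (\<lambda>x. 0 :: 'a)" by (rule clinearI) simp_all
  then show ?thesis using opnorm_eq_0[OF I, of "\<lambda>x. 0"] True by simp
next
  case False
  have cf: "clinear (\<lambda>x. c *\<^sub>C f x)"
    using f by (simp add: clinear_iff scaleC_add_right scaleC_scaleC mult.commute)
  have b: "cmod c * inorm I (f x) \<le> opnorm I (\<lambda>x. c *\<^sub>C f x) * inorm I x" for x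
    using opnorm_bound[OF I cf, of x] by (simp add: inorm_scale[OF I])
  have "opnorm I f \<le> opnorm I (\<lambda>x. c *\<^sub>C f x) / cmod c"
    by (rule opnorm_le) (use b False opnorm_nonneg[OF I cf] in \<open>auto simp: field_simps\<close>)
  moreover have "opnorm I (\<lambda>x. c *\<^sub>C f x) \<le> cmod c * opnorm I f"
    by (rule opnorm_le) (use opnorm_bound[OF I f] opnorm_nonneg[OF I f] in
        \<open>auto simp: inorm_scale[OF I] mult.assoc intro: mult_left_mono\<close>)
  ultimately show ?thesis using False by (simp add: field_simps)
qed

text \<open>Estimate the square of the norm of \<open>g x\<close>, which is the inner product of
  \<open>f (g x)\<close> and \<open>x\<close>, and cancel one factor.\<close>

lemma opnorm_adjoint_le:
  fixes I :: "'a::fd_complex_vector cinner"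
  assumes I: "is_cinner I" and f: "clinear f" and adj: "\<And>x y. I (f x) y = I x (g y)"
  shows "opnorm I g \<le> opnorm I f"
proof (rule opnorm_le)
  fix x
  have "(inorm I (g x))\<^sup>2 \<le> cmod (I (g x) (g x))"
    unfolding inorm_square[OF I] by (rule complex_Re_le_cmod)
  also have "\<dots> = cmod (I (f (g x)) x)" by (simp add: adj)
  also have "\<dots> \<le> inorm I (f (g x)) * inorm I x" by (rule inorm_cauchy_schwarz[OF I])
  also have "\<dots> \<le> opnorm I f * inorm I (g x) * inorm I x"
    by (intro mult_right_mono opnorm_bound[OF I f] inorm_nonneg[OF I])
  finally have "inorm I (g x) * inorm I (g x) \<le> inorm I (g x) * (opnorm I f * inorm I x)"
    by (simp add: power2_eq_square ac_simps)
  then show "inorm I (g x) \<le> opnorm I f * inorm I x"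
    using inorm_nonneg[OF I, of "g x"] inorm_nonneg[OF I, of x] opnorm_nonneg[OF I f]
    by (cases "inorm I (g x) = 0") (simp_all add: mult_le_cancel_left)
qed (rule opnorm_nonneg[OF I f])

text \<open>The C*-identity for operators, later specialized to left multiplications. One inequality
  is submultiplicativity with the bound on the adjoint; the other is Cauchy-Schwarz for
  \<open>I x (g (f x))\<close>.\<close>

lemma opnorm_adjoint_compose:
  fixes I :: "'a::fd_complex_vector cinner"
  assumes I: "is_cinner I" and f: "clinear f" and g: "clinear g"
    and adj: "\<And>x y. I (f x) y = I x (g y)"
  shows "opnorm I (\<lambda>x. g (f x)) = (opnorm I f)\<^sup>2"
proof (rule antisym)
  have gf: "clinear (\<lambda>x. g (f x))" by (rule clinear_compose[OF g f])
  have "opnorm I (\<lambda>x. g (f x)) \<le> opnorm I g * opnorm I f" by (rule opnorm_compose_le[OF I g f])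
  also have "\<dots> \<le> opnorm I f * opnorm I f"
    by (intro mult_right_mono opnorm_adjoint_le[OF I f adj] opnorm_nonneg[OF I f])
  finally show "opnorm I (\<lambda>x. g (f x)) \<le> (opnorm I f)\<^sup>2" by (simp add: power2_eq_square)
  have "opnorm I f \<le> sqrt (opnorm I (\<lambda>x. g (f x)))"
  proof (rule opnorm_le)
    fix x
    have "(inorm I (f x))\<^sup>2 \<le> cmod (I (f x) (f x))"
      unfolding inorm_square[OF I] by (rule complex_Re_le_cmod)
    also have "\<dots> \<le> inorm I x * inorm I (g (f x))"
      unfolding adj by (rule inorm_cauchy_schwarz[OF I])
    also have "\<dots> \<le> inorm I x * (opnorm I (\<lambda>x. g (f x)) * inorm I x)"
      by (intro mult_left_mono opnorm_bound[OF I gf] inorm_nonneg[OF I])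
    also have "\<dots> = (sqrt (opnorm I (\<lambda>x. g (f x))) * inorm I x)\<^sup>2"
      by (simp add: power_mult_distrib opnorm_nonneg[OF I gf] power2_eq_square)
    finally show "inorm I (f x) \<le> sqrt (opnorm I (\<lambda>x. g (f x))) * inorm I x"
      by (rule power2_le_imp_le) (simp add: opnorm_nonneg[OF I gf] inorm_nonneg[OF I])
  qed (simp add: opnorm_nonneg[OF I gf])
  then show "(opnorm I f)\<^sup>2 \<le> opnorm I (\<lambda>x. g (f x))"
    using opnorm_nonneg[OF I f] opnorm_nonneg[OF I gf] real_le_rsqrt sqrt_le_D
    by (metis real_sqrt_le_iff real_sqrt_pow2 power_mono)
qed

section \<open>Eigenvectors for the largest singular value\<close>

lemma clinear_injective_isomorphism:
  fixes f :: "'a::fd_complex_vector \<Rightarrow> 'a"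
  assumes "clinear f" "inj f"
  obtains g where "clinear g" "\<And>x. g (f x) = x" "\<And>x. f (g x) = x"
proof -
  obtain S :: "'a set" where S: "finite S" "complex_vector.span S = UNIV"
    using finite_spanning_set by blast
  \<comment> \<open>The type class yields a finite spanning set; a maximal independent subset of it
    is the basis for the interpretation.\<close>
  obtain B where B: "B \<subseteq> S" "complex_vector.independent B" "S \<subseteq> complex_vector.span B"
    by (rule complex_vector.maximal_independent_subset)
  have "complex_vector.span B = UNIV"
    using complex_vector.span_mono[OF B(3)] S(2) by (simp add: complex_vector.span_span top_unique)
  then interpret fd: finite_dimensional_vector_space "scaleC :: complex \<Rightarrow> 'a \<Rightarrow> 'a" B
    using B S(1) by unfold_locales (auto intro: finite_subset)
  show thesis
    by (rule that[of "inv f"])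
      (use assms fd.inj_linear_imp_inv_linear fd.linear_inj_imp_surj in \<open>auto simp: surj_f_inv_f\<close>)
qed

text \<open>If \<open>N\<^sup>2 - f\<^sup>* f\<close> were injective, it would be bounded below by some \<open>\<epsilon> > 0\<close>, and the bound
  \<open>N\<close> on \<open>f\<close> would not be optimal.\<close>

lemma opnorm_attained:
  fixes I :: "'a::fd_complex_vector cinner"
  assumes I: "is_cinner I" and f: "clinear f" and g: "clinear g"
    and adj: "\<And>x y. I (f x) y = I x (g y)" and nontrivial: "\<exists>x :: 'a. x \<noteq> 0"
  shows "\<exists>v. v \<noteq> 0 \<and> g (f v) = of_real ((opnorm I f)\<^sup>2) *\<^sub>C v"
proof (rule ccontr)
  assume no_eigenvector: "\<not> ?thesis"
  define N where "N = opnorm I f"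
  define T where "T v = of_real (N\<^sup>2) *\<^sub>C v - g (f v)" for v
  note bound = opnorm_bound[OF I f, folded N_def] and N0 = opnorm_nonneg[OF I f, folded N_def]
  have T_lin: "clinear T"
    by (rule clinearI) (simp_all add: T_def clinear_add[OF f] clinear_add[OF g] clinear_scale[OF f]
        clinear_scale[OF g] scaleC_add_right complex_vector.scale_right_diff_distrib scaleC_scaleC mult.commute)
  have T_inj: "inj T"
  proof (rule injI)
    fix x y assume "T x = T y"
    then have "T (x - y) = 0" by (simp add: clinear_diff[OF T_lin])
    then have "x - y = 0" using no_eigenvector unfolding T_def N_def by (metis eq_iff_diff_eq_0)
    then show "x = y" by simp
  qed
  obtain R where R: "clinear R" "\<And>x. R (T x) = x" "\<And>x. T (R x) = x"
    by (rule clinear_injective_isomorphism[OF T_lin T_inj], rule that)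
  \<comment> \<open>\<open>F\<close> is positive because \<open>N\<close> bounds \<open>f\<close>,
    which makes Cauchy-Schwarz available for it.\<close>
  define F where "F x y = I x (T y)" for x y
  have F: "F x y = of_real (N\<^sup>2) * I x y - I (f x) (f y)" for x y
    using clinear_diff[OF clinear_cinner[OF I, of x]]
    by (simp add: F_def T_def cinner_simps[OF I] adj)
  have F_diag: "Re (F x x) = N\<^sup>2 * (inorm I x)\<^sup>2 - (inorm I (f x))\<^sup>2" for x
    by (simp add: F inorm_square[OF I])
  interpret F: positive_form F
  proof (rule positive_form.intro)
    show "clinear (F x)" for x
      unfolding F_def by (rule clinear_compose[OF clinear_cinner[OF I] T_lin])
    show "F y x = cnj (F x y)" for x y
      using cinner_commute[OF I, of y x] cinner_commute[OF I, of "f y" "f x"] by (simp add: F)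
    show "0 \<le> Re (F x x)" for x
      using power_mono[OF bound inorm_nonneg[OF I], of x 2] by (simp add: F_diag power_mult_distrib)
  qed
  obtain K0 where K0: "0 \<le> K0" "\<And>x. inorm I (R x) \<le> K0 * inorm I x"
    by (rule clinear_bounded[OF I R(1)], rule that)
  \<comment> \<open>The summand 1 makes the bound on the inverse of \<open>T\<close> strictly
    positive, so that \<open>1 / K\<close> can be the gain below.\<close>
  define K where "K = K0 + 1"
  have K: "K > 0" "inorm I (R x) \<le> K * inorm I x" for x
    using K0(1) K0(2)[of x] inorm_nonneg[OF I, of x] by (auto simp: K_def distrib_right)
  \<comment> \<open>Cauchy-Schwarz for \<open>F\<close> at \<open>v\<close> and its preimage
    \<open>R v\<close> under \<open>T\<close>: \<open>F v (R v)\<close> is the squared norm of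
    \<open>v\<close>, and \<open>F (R v) (R v)\<close> is at most \<open>K\<close> times
    that.\<close>
  have below: "(inorm I v)\<^sup>2 \<le> K * Re (F v v)" for v
  proof (cases "v = 0")
    case True
    then show ?thesis using K F.nonneg inorm_eq_0[OF I, of v] by simp
  next
    case False
    let ?w = "R v"
    have "cmod (F v ?w) = (inorm I v)\<^sup>2"
      unfolding F_def R(3) inorm_square[OF I] using cinner_self[OF I, of v]
      by (metis norm_of_real abs_of_nonneg)
    then have cs: "((inorm I v)\<^sup>2)\<^sup>2 \<le> Re (F v v) * Re (F ?w ?w)"
      using F.cauchy_schwarz[of v ?w] by simp
    have "Re (F ?w ?w) \<le> inorm I ?w * inorm I v"
      unfolding F_def R(3) using inorm_cauchy_schwarz[OF I] complex_Re_le_cmod order_trans by blast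
    also have "\<dots> \<le> K * inorm I v * inorm I v"
      by (intro mult_right_mono K inorm_nonneg[OF I])
    finally have "Re (F v v) * Re (F ?w ?w) \<le> Re (F v v) * (K * inorm I v * inorm I v)"
      by (rule mult_left_mono) (rule F.nonneg)
    with cs have "(inorm I v)\<^sup>2 * (inorm I v)\<^sup>2 \<le> (inorm I v)\<^sup>2 * (K * Re (F v v))"
      by (simp add: power2_eq_square ac_simps)
    moreover have "0 < (inorm I v)\<^sup>2" using False inorm_eq_0[OF I, of v] by simp
    ultimately show ?thesis by (rule mult_left_le_imp_le)
  qed
  have improved: "(inorm I (f v))\<^sup>2 \<le> (N\<^sup>2 - 1 / K) * (inorm I v)\<^sup>2" for v
    using below[of v] K(1) by (simp add: F_diag field_simps)
  \<comment> \<open>A nonzero vector forces \<open>N\<^sup>2 - 1 / K\<close> to be nonnegative, so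
    its square root is an admissible bound for \<open>f\<close>, smaller than
    \<open>N\<close>.\<close>
  obtain u :: 'a where "u \<noteq> 0" using nontrivial by blast
  then have "0 < (inorm I u)\<^sup>2" using inorm_eq_0[OF I, of u] by simp
  moreover have "0 \<le> (N\<^sup>2 - 1 / K) * (inorm I u)\<^sup>2" using improved[of u] by (meson order_trans zero_le_power2)
  ultimately have ge: "0 \<le> N\<^sup>2 - 1 / K" by (simp add: zero_le_mult_iff)
  have "N \<le> sqrt (N\<^sup>2 - 1 / K)"
    unfolding N_def
  proof (rule opnorm_le)
    show "0 \<le> sqrt ((opnorm I f)\<^sup>2 - 1 / K)" using ge by (simp add: N_def)
    show "inorm I (f x) \<le> sqrt ((opnorm I f)\<^sup>2 - 1 / K) * inorm I x" for x
      using real_sqrt_le_mono[OF improved[of x]] inorm_nonneg[OF I]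
      by (simp add: real_sqrt_mult N_def)
  qed
  then have "N\<^sup>2 \<le> N\<^sup>2 - 1 / K" using N0 ge by (metis power_mono real_sqrt_pow2)
  then show False using K(1) by simp
qed

section \<open>Unital Hilbert algebras\<close>

text \<open>The common ground of both sides: Frobenius algebras and GNS spaces are both instances.
  Of \<open>star\<close> only the adjoint relation is assumed; the laws of an involution are
  derived.\<close>

locale unital_hilbert_algebra =
  fixes I :: "'a::fd_complex_vector cinner"
    and mul :: "'a \<Rightarrow> 'a \<Rightarrow> 'a"  (infixl \<open>\<cdot>\<close> 70)
    and e :: 'a
    and star :: "'a \<Rightarrow> 'a"
  assumes inner: "is_cinner I"
    and bilinear: "cbilinear (\<cdot>)"
    and assoc: "(x \<cdot> y) \<cdot> z = x \<cdot> (y \<cdot> z)"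
    and left_unit: "e \<cdot> x = x"
    and right_unit: "x \<cdot> e = x"
    and left_adjoint: "I (x \<cdot> y) z = I y (star x \<cdot> z)"
    and unit_normalized: "I e e = 1"
begin

lemmas inner_simps = cinner_simps[OF inner]

lemma clinear_left: "clinear ((\<cdot>) x)"
  and clinear_right: "clinear (\<lambda>y. y \<cdot> x)"
  using bilinear by (simp_all add: cbilinear_def)

lemma mul_simps:
  "x \<cdot> (y + z) = x \<cdot> y + x \<cdot> z" "x \<cdot> (c *\<^sub>C y) = c *\<^sub>C (x \<cdot> y)"
  "(x + y) \<cdot> z = x \<cdot> z + y \<cdot> z" "(c *\<^sub>C x) \<cdot> y = c *\<^sub>C (x \<cdot> y)"
  using clinear_add[OF clinear_left] clinear_scale[OF clinear_left]
    clinear_add[OF clinear_right] clinear_scale[OF clinear_right] by blast+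

lemma left_adjoint': "I (star x \<cdot> y) z = I y (x \<cdot> z)"
  using left_adjoint[of x z y] cinner_commute[OF inner] by metis

text \<open>An element is recovered from its left multiplication by applying it to \<open>e\<close>.
  The laws of \<open>star\<close> thus reduce to uniqueness of adjoints.\<close>

lemma star_eqI:
  assumes "\<And>y z. I (x \<cdot> y) z = I y (u \<cdot> z)"
  shows "star x = u"
proof -
  have "star x \<cdot> e = u \<cdot> e"
    by (rule cinner_eqI[OF inner]) (metis assms left_adjoint)
  then show ?thesis by (simp add: right_unit)
qed

lemma star_star: "star (star x) = x"
  by (rule star_eqI) (rule left_adjoint')

lemma star_mul: "star (x \<cdot> y) = star y \<cdot> star x"
  by (rule star_eqI) (simp add: assoc left_adjoint)

lemma antilinear_star: "antilinear star"
  unfolding antilinear_def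
  by (intro conjI allI star_eqI) (simp_all add: mul_simps inner_simps left_adjoint)

text \<open>This writes the inner product through the functional \<open>I e\<close>, whose
  positivity and faithfulness are then those of \<open>I\<close>.\<close>

lemma inner_unit: "I e (star x \<cdot> y) = I x y"
  using left_adjoint[of x e y] by (simp add: right_unit)

lemma star_unit: "star e = e"
  by (rule star_eqI) (simp add: left_unit)

lemma unit_nonzero: "e \<noteq> 0"
  using unit_normalized clinear_0[OF clinear_cinner[OF inner]] by auto

text \<open>The second Frobenius identity: moving \<open>a\<close> to the other side as
  \<open>star a\<close> reduces it to associativity.\<close>

lemma right_adjoint:
  "adjoint I I (\<lambda>a. a \<cdot> y) (a \<cdot> b) = a \<cdot> adjoint I I (\<lambda>a. a \<cdot> y) b"
proof (rule cinner_eqI[OF inner])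
  fix z
  note adj = adjoint_eq[OF inner inner clinear_right[of y], symmetric]
  show "I z (adjoint I I (\<lambda>a. a \<cdot> y) (a \<cdot> b)) = I z (a \<cdot> adjoint I I (\<lambda>a. a \<cdot> y) b)"
    by (simp add: adj assoc flip: left_adjoint')
qed

text \<open>Turns the first Frobenius identity into associativity, and identifies
  \<open>frobenius_S\<close> with \<open>star\<close> on evaluation at \<open>e\<close>.\<close>

lemma left_adjoint_eq: "adjoint I I ((\<cdot>) x) = (\<cdot>) (star x)"
proof
  show "adjoint I I ((\<cdot>) x) z = star x \<cdot> z" for z
    by (rule cinner_eqI[OF inner])
      (simp add: adjoint_eq[OF inner inner clinear_left, symmetric] left_adjoint)
qed

section \<open>Existence and uniqueness of the C*-norm\<close>

abbreviation mul_norm :: "'a \<Rightarrow> real" where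
  "mul_norm x \<equiv> opnorm I ((\<cdot>) x)"

lemma mul_norm_star_mul: "mul_norm (star x \<cdot> x) = (mul_norm x)\<^sup>2"
proof -
  have "(\<cdot>) (star x \<cdot> x) = (\<lambda>y. star x \<cdot> (x \<cdot> y))" by (simp add: fun_eq_iff assoc)
  moreover have "opnorm I (\<lambda>y. star x \<cdot> (x \<cdot> y)) = (mul_norm x)\<^sup>2"
    by (rule opnorm_adjoint_compose) (rule inner clinear_left left_adjoint)+
  ultimately show ?thesis by metis
qed

text \<open>The norm axioms are inherited from operators along \<open>x \<mapsto> L\<^sub>x\<close>;
  definiteness uses that \<open>L\<^sub>x\<close> sends \<open>e\<close> to
  \<open>x\<close>.\<close>

lemma cstar_algebra_mul_norm:
  "cstar_algebra \<lparr>cmult = (\<cdot>), cone = e, cstar = star, cnorm = mul_norm\<rparr>"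
  unfolding cstar_algebra_def cstar.simps
proof (intro conjI allI)
  fix x y z :: 'a and c :: complex
  show "0 \<le> mul_norm x" by (rule opnorm_nonneg[OF inner clinear_left])
  show "mul_norm x = 0 \<longleftrightarrow> x = 0"
    unfolding opnorm_eq_0[OF inner clinear_left]
    using right_unit[of x] clinear_0[OF clinear_right] by metis
  have "(\<cdot>) (x + y) = (\<lambda>z. x \<cdot> z + y \<cdot> z)" by (simp add: fun_eq_iff mul_simps)
  then show "mul_norm (x + y) \<le> mul_norm x + mul_norm y"
    by (simp only: opnorm_add_le[OF inner clinear_left clinear_left])
  have "(\<cdot>) (c *\<^sub>C x) = (\<lambda>z. c *\<^sub>C (x \<cdot> z))" by (simp add: fun_eq_iff mul_simps)
  then show "mul_norm (c *\<^sub>C x) = cmod c * mul_norm x"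
    by (simp only: opnorm_scale[OF inner clinear_left])
  have "(\<cdot>) (x \<cdot> y) = (\<lambda>z. x \<cdot> (y \<cdot> z))" by (simp add: fun_eq_iff assoc)
  then show "mul_norm (x \<cdot> y) \<le> mul_norm x * mul_norm y"
    by (simp only: opnorm_compose_le[OF inner clinear_left clinear_left])
qed (simp_all add: bilinear assoc left_unit right_unit antilinear_star star_star star_mul mul_norm_star_mul)

lemma faithful_state_unit:
  "faithful_state \<lparr>cmult = (\<cdot>), cone = e, cstar = star, cnorm = n\<rparr> (I e)"
  using inner unfolding faithful_state_def is_cinner_def cstar.simps inner_unit
  by (intro conjI unit_normalized) blast+

text \<open>The lower bound: an eigenvector of \<open>star x \<cdot> x\<close> in \<open>A\<close> itself turns submultiplicativity
  of the norm into a bound on the eigenvalue.\<close>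

lemma mul_norm_le_cstar_norm:
  assumes A: "cstar_algebra \<lparr>cmult = (\<cdot>), cone = e, cstar = star, cnorm = n\<rparr>"
  shows "mul_norm x \<le> n x"
proof -
  have nonneg: "0 \<le> n x" and eq0: "n x = 0 \<longleftrightarrow> x = 0" and scale: "n (c *\<^sub>C x) = cmod c * n x"
    and submult: "n (x \<cdot> y) \<le> n x * n y" and cstar: "n (star x \<cdot> x) = (n x)\<^sup>2" for x y c
    using A by (auto simp: cstar_algebra_def)
  have "\<exists>v. v \<noteq> 0 \<and> star x \<cdot> (x \<cdot> v) = of_real ((mul_norm x)\<^sup>2) *\<^sub>C v"
    by (rule opnorm_attained) (rule inner clinear_left left_adjoint exI[of _ e] unit_nonzero)+
  then obtain v where v: "v \<noteq> 0" "star x \<cdot> (x \<cdot> v) = of_real ((mul_norm x)\<^sup>2) *\<^sub>C v"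
    by blast
  have "(mul_norm x)\<^sup>2 * n v = n ((star x \<cdot> x) \<cdot> v)"
    by (simp only: assoc v scale norm_of_real) simp
  also have "\<dots> \<le> (n x)\<^sup>2 * n v"
    using submult[of "star x \<cdot> x" v] by (simp add: cstar)
  finally have "(mul_norm x)\<^sup>2 \<le> (n x)\<^sup>2"
    using v(1) nonneg[of v] eq0[of v] by (simp add: mult_le_cancel_right)
  then show ?thesis using nonneg by (rule power2_le_imp_le)
qed

text \<open>The upper bound: by the C*-identity \<open>n (h ^ 2 ^ k) = n h ^ 2 ^ k\<close> for self-adjoint \<open>h\<close>, so the
  constant in \<open>n y \<le> C \<parallel>y\<parallel>\<close> disappears in the limit of large powers.\<close>

lemma cstar_norm_le_mul_norm:
  assumes A: "cstar_algebra \<lparr>cmult = (\<cdot>), cone = e, cstar = star, cnorm = n\<rparr>"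
  shows "n x \<le> mul_norm x"
proof -
  have nonneg: "0 \<le> n x" and add: "n (x + y) \<le> n x + n y" and scale: "n (c *\<^sub>C x) = cmod c * n x"
    and cstar: "n (star x \<cdot> x) = (n x)\<^sup>2" for x y c
    using A by (auto simp: cstar_algebra_def)
  obtain C where C: "0 \<le> C" "\<And>y. n y \<le> C * inorm I y"
    by (rule seminorm_bounded[OF inner, of n, OF nonneg add scale], rule that)
  \<comment> \<open>The power of \<open>star x \<cdot> x\<close> with exponent \<open>2 ^ k\<close>,
    by repeated squaring, since the C*-identity controls squares of self-adjoint elements for both
    norms.\<close>
  define h where "h k = ((\<lambda>y. y \<cdot> y) ^^ k) (star x \<cdot> x)" for k
  have h_Suc: "h (Suc k) = h k \<cdot> h k" and h_0: "h 0 = star x \<cdot> x" for k by (simp_all add: h_def)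
  have h_star: "star (h k) = h k" for k
    by (induction k) (simp_all add: h_0 h_Suc star_mul star_star)
  have n_h: "n (h k) = ((n x)\<^sup>2) ^ 2 ^ k" for k
  proof (induction k)
    case (Suc k)
    have "n (h (Suc k)) = (n (h k))\<^sup>2" using cstar[of "h k"] by (simp add: h_Suc h_star)
    then show ?case by (simp add: Suc ac_simps flip: power_mult)
  qed (simp add: h_0 cstar)
  have mul_h: "mul_norm (h k) = ((mul_norm x)\<^sup>2) ^ 2 ^ k" for k
  proof (induction k)
    case (Suc k)
    have "mul_norm (h (Suc k)) = (mul_norm (h k))\<^sup>2"
      using mul_norm_star_mul[of "h k"] by (simp add: h_Suc h_star)
    then show ?case by (simp add: Suc ac_simps flip: power_mult)
  qed (simp add: h_0 mul_norm_star_mul)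
  let ?a = "(n x)\<^sup>2" and ?b = "(mul_norm x)\<^sup>2"
  have unit: "inorm I e = 1" by (simp add: inorm_def unit_normalized)
  \<comment> \<open>\<open>C\<close> compares \<open>n\<close> with the Hilbert norm, and the
    Hilbert norm of \<open>h k = h k \<cdot> e\<close> is at most \<open>mul_norm (h k)\<close>
    because \<open>e\<close> has norm 1.\<close>
  have pow: "?a ^ 2 ^ k \<le> C * ?b ^ 2 ^ k" for k
  proof -
    have "inorm I (h k) \<le> mul_norm (h k)"
      using opnorm_bound[OF inner clinear_left, of "h k" e] by (simp add: right_unit unit)
    then have "C * inorm I (h k) \<le> C * mul_norm (h k)" by (rule mult_left_mono) (rule C(1))
    then show ?thesis using C(2)[of "h k"] unfolding n_h mul_h by linarith
  qed
  have "?a \<le> ?b"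
  proof (rule ccontr)
    assume "\<not> ?a \<le> ?b"
    then have less: "?b < ?a" by simp
    show False
    proof (cases "?b = 0")
      case True
      then show False using pow[of 0] less by simp
    next
      case False
      then have b: "0 < ?b" by (metis less_eq_real_def zero_le_power2)
      \<comment> \<open>All powers of \<open>r > 1\<close> with exponent \<open>2 ^ k\<close> would
        be bounded by \<open>C\<close>.\<close>
      define r where "r = ?a / ?b"
      have r: "1 < r" using less b by (simp add: r_def)
      have rC: "r ^ 2 ^ k \<le> C" for k
        using pow[of k] b unfolding r_def power_divide by (subst pos_divide_le_eq) auto
      obtain m where "C < r ^ m" using real_arch_pow[OF r] by blast
      also have "r ^ m \<le> r ^ 2 ^ m" using r by (intro power_increasing) (auto intro: less_imp_le)
      finally show False using rC[of m] by simp
    qed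
  qed
  then show ?thesis
    by (rule power2_le_imp_le) (rule opnorm_nonneg[OF inner clinear_left])
qed

end

section \<open>The GNS space as a unital Hilbert algebra\<close>

lemma unital_hilbert_algebra_gns:
  assumes "cstar_algebra A" "faithful_state A \<omega>"
  shows "unital_hilbert_algebra (gns_inner A \<omega>) (cmult A) (cone A) (cstar A)"
proof -
  have bil: "cbilinear (cmult A)" and anti: "antilinear (cstar A)"
    and assoc: "cmult A (cmult A x y) z = cmult A x (cmult A y z)"
    and unit: "cmult A (cone A) x = x" "cmult A x (cone A) = x"
    and star: "cstar A (cstar A x) = x" "cstar A (cmult A x y) = cmult A (cstar A y) (cstar A x)"
    for x y z using assms(1) unfolding cstar_algebra_def by blast+
  have lin: "clinear \<omega>" and pos: "\<omega> (cmult A (cstar A x) x) \<in> \<real>\<^sub>\<ge>\<^sub>0" and one: "\<omega> (cone A) = 1"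
    and faithful: "\<omega> (cmult A (cstar A x) x) = 0 \<Longrightarrow> x = 0" for x
    using assms(2) unfolding faithful_state_def by blast+
  have mul: "cmult A x (y + z) = cmult A x y + cmult A x z" "cmult A x (c *\<^sub>C y) = c *\<^sub>C cmult A x y"
    "cmult A (x + y) z = cmult A x z + cmult A y z" "cmult A (c *\<^sub>C x) y = c *\<^sub>C cmult A x y" for x y z c
    using bil by (auto simp: cbilinear_def clinear_iff)
  have anti': "cstar A (x + y) = cstar A x + cstar A y" "cstar A (c *\<^sub>C x) = cnj c *\<^sub>C cstar A x" for x y c
    using anti by (simp_all add: antilinear_def)
  have star_one: "cstar A (cone A) = cone A"
    using star(2)[of "cstar A (cone A)" "cone A"] by (simp add: unit star(1))
  let ?I = "gns_inner A \<omega>"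
  note I_lin = clinear_add[OF lin] clinear_scale[OF lin]
  have herm: "?I y x = cnj (?I x y)" for x y
  proof (rule hermitian_of_real_diagonal[where G = ?I])
    show "Im (?I x x) = 0" for x
      using pos[of x] by (auto simp: gns_inner_def nonneg_Reals_def)
  qed (simp_all add: gns_inner_def mul anti' I_lin scaleC_complex_mult)
  have "is_cinner ?I"
    unfolding is_cinner_def
  proof (intro conjI allI impI)
    show "clinear (?I x)" for x
      by (rule clinearI) (simp_all add: gns_inner_def mul I_lin)
    show "x = 0" if "?I x x = 0" for x using that unfolding gns_inner_def by (rule faithful)
  qed (rule herm, simp add: gns_inner_def pos)
  then show ?thesis
  proof (rule unital_hilbert_algebra.intro)
    show "?I (cmult A x y) z = ?I y (cmult A (cstar A x) z)" for x y z
      by (simp add: gns_inner_def star assoc)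
    show "?I (cone A) (cone A) = 1" by (simp add: gns_inner_def star_one unit one)
  qed (fact bil assoc unit)+
qed

section \<open>The Frobenius axioms in terms of the product\<close>

lemma clinear_tensor_eq_iff:
  fixes f g :: "('a::complex_vector, 'b::complex_vector) tensor \<Rightarrow> 'c::complex_vector"
  assumes "clinear f" "clinear g"
  shows "f = g \<longleftrightarrow> (\<forall>x y. f (x \<otimes>\<^sub>v y) = g (x \<otimes>\<^sub>v y))"
  using clinear_tensor_eqI[OF assms] by blast

lemma clinear_tensor3_eq_iff:
  fixes f g :: "(('a::complex_vector, 'b::complex_vector) tensor, 'c::complex_vector) tensor \<Rightarrow> 'd::complex_vector"
  assumes f: "clinear f" and g: "clinear g"
  shows "f = g \<longleftrightarrow> (\<forall>x y z. f ((x \<otimes>\<^sub>v y) \<otimes>\<^sub>v z) = g ((x \<otimes>\<^sub>v y) \<otimes>\<^sub>v z))" (is "_ \<longleftrightarrow> ?R")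
proof
  assume R: ?R
  have "f (t \<otimes>\<^sub>v z) = g (t \<otimes>\<^sub>v z)" for t z
    by (induction t rule: tensor_induct)
      (simp_all add: R tensor_vec_simps clinear_add[OF f] clinear_add[OF g])
  then show "f = g" by (simp add: clinear_tensor_eq_iff[OF f g])
qed simp

lemma clinear_id: "clinear (id :: 'a::complex_vector \<Rightarrow> 'a)"
  by (rule clinearI) simp_all

lemma clinear_comp: "clinear f \<Longrightarrow> clinear g \<Longrightarrow> clinear (f \<circ> g)"
  by (simp add: comp_def clinear_compose)

lemma clinear_from_complex: "clinear i \<Longrightarrow> i c = c *\<^sub>C i 1" for i :: "complex \<Rightarrow> 'a::complex_vector"
  using clinear_scale[of i c 1] by (simp add: scaleC_complex_mult)

lemma clinear_mult_tensor_vec: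
  assumes "clinear m"
  shows "clinear (\<lambda>y. m (x \<otimes>\<^sub>v y))" "clinear (\<lambda>x. m (x \<otimes>\<^sub>v y))"
  by (rule clinearI; simp add: tensor_vec_simps clinear_add[OF assms] clinear_scale[OF assms])+

text \<open>The values of \<open>m\<^sup>*\<close> are accessible only through inner products; this
  allows them to be compared there.\<close>

lemma tensor_inner_eqI:
  fixes I :: "'a::fd_complex_vector cinner" and J :: "'b::complex_vector cinner"
  assumes I: "is_cinner I" and J: "is_cinner J"
    and eq: "\<And>x y. tensor_inner I J (x \<otimes>\<^sub>v y) s = tensor_inner I J (x \<otimes>\<^sub>v y) t"
  shows "s = t"
proof (rule cinner_eqI[OF is_cinner_tensor[OF I J]])
  show "tensor_inner I J u s = tensor_inner I J u t" for u
    by (induction u rule: tensor_induct) (simp_all add: eq tensor_inner_sesquilinear[OF I J])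
qed

section \<open>Associativity, unitality and the Frobenius identities\<close>

lemma associativity_iff:
  fixes m :: "('a::complex_vector, 'a) tensor \<Rightarrow> 'a"
  assumes m: "clinear m"
  shows "m \<circ> (m \<otimes>\<^sub>l id) = m \<circ> (id \<otimes>\<^sub>l m) \<circ> associator \<longleftrightarrow>
    (\<forall>x y z. m (m (x \<otimes>\<^sub>v y) \<otimes>\<^sub>v z) = m (x \<otimes>\<^sub>v m (y \<otimes>\<^sub>v z)))"
proof -
  note lin = m clinear_id associator_vec(1) tensor_map_vec(1)[OF m clinear_id] tensor_map_vec(1)[OF clinear_id m]
  have lin: "clinear (m \<circ> (m \<otimes>\<^sub>l id))" "clinear (m \<circ> (id \<otimes>\<^sub>l m) \<circ> associator)"
    by (intro clinear_comp lin)+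
  show ?thesis
    by (simp add: clinear_tensor3_eq_iff[OF lin] associator_vec(2) tensor_map_vec(2)[OF m clinear_id]
        tensor_map_vec(2)[OF clinear_id m])
qed

lemma unitality_iff:
  fixes m :: "('a::complex_vector, 'a) tensor \<Rightarrow> 'a" and i :: "complex \<Rightarrow> 'a"
  assumes m: "clinear m" and i: "clinear i"
  shows "m \<circ> (i \<otimes>\<^sub>l id) = left_unitor \<longleftrightarrow> (\<forall>x. m (i 1 \<otimes>\<^sub>v x) = x)"
    and "m \<circ> (id \<otimes>\<^sub>l i) = right_unitor \<longleftrightarrow> (\<forall>x. m (x \<otimes>\<^sub>v i 1) = x)"
proof -
  have il: "m (i c \<otimes>\<^sub>v x) = c *\<^sub>C m (i 1 \<otimes>\<^sub>v x)" and ir: "m (x \<otimes>\<^sub>v i c) = c *\<^sub>C m (x \<otimes>\<^sub>v i 1)" for c x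
    by (subst clinear_from_complex[OF i], simp add: tensor_vec_simps clinear_scale[OF m])+
  have 1: "m \<circ> (i \<otimes>\<^sub>l id) = left_unitor \<longleftrightarrow> (\<forall>c x. m (i c \<otimes>\<^sub>v x) = c *\<^sub>C x)"
    by (subst clinear_tensor_eq_iff[OF clinear_comp[OF m tensor_map_vec(1)[OF i clinear_id]] unitor_vec(3)])
      (simp add: tensor_map_vec(2)[OF i clinear_id] unitor_vec)
  show "m \<circ> (i \<otimes>\<^sub>l id) = left_unitor \<longleftrightarrow> (\<forall>x. m (i 1 \<otimes>\<^sub>v x) = x)"
    unfolding 1 by (metis il scaleC_one)
  have 2: "m \<circ> (id \<otimes>\<^sub>l i) = right_unitor \<longleftrightarrow> (\<forall>x c. m (x \<otimes>\<^sub>v i c) = c *\<^sub>C x)"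
    by (subst clinear_tensor_eq_iff[OF clinear_comp[OF m tensor_map_vec(1)[OF clinear_id i]] unitor_vec(4)])
      (simp add: tensor_map_vec(2)[OF clinear_id i] unitor_vec)
  show "m \<circ> (id \<otimes>\<^sub>l i) = right_unitor \<longleftrightarrow> (\<forall>x. m (x \<otimes>\<^sub>v i 1) = x)"
    unfolding 2 by (metis ir scaleC_one)
qed

text \<open>Testing the two Frobenius identities against \<open>a \<otimes> b\<close> eliminates \<open>m\<^sup>*\<close>: they say that the
  adjoint of a left multiplication commutes with right multiplications, and vice versa.\<close>

context
  fixes I :: "'a::fd_complex_vector cinner" and m :: "('a, 'a) tensor \<Rightarrow> 'a"
    and m' :: "'a \<Rightarrow> ('a, 'a) tensor"
  assumes I: "is_cinner I" and m: "clinear m"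
    and m'_def: "m' = adjoint (tensor_inner I I) I m"
begin

lemma m': "clinear m'" "tensor_inner I I t (m' x) = I (m t) x"
  using clinear_adjoint[OF is_cinner_tensor[OF I I] I m] adjoint_eq[OF is_cinner_tensor[OF I I] I m, of t x]
  by (simp_all add: m'_def)

lemma frobenius_left_iff:
  "(m \<otimes>\<^sub>l id) \<circ> associator_inv \<circ> (id \<otimes>\<^sub>l m') = m' \<circ> m \<longleftrightarrow>
   (\<forall>x a b. adjoint I I (\<lambda>y. m (x \<otimes>\<^sub>v y)) (m (a \<otimes>\<^sub>v b)) = m (adjoint I I (\<lambda>y. m (x \<otimes>\<^sub>v y)) a \<otimes>\<^sub>v b))"
proof -
  define L where "L x = adjoint I I (\<lambda>y. m (x \<otimes>\<^sub>v y))" for x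
  have L: "I (L x a) y = I a (m (x \<otimes>\<^sub>v y))" for x a y
    using adjoint_eq[OF I I clinear_mult_tensor_vec(1)[OF m], of x y a]
      cinner_commute[OF I] by (metis L_def)
  \<comment> \<open>Needed for \<open>t = m' y\<close>, which is in general no simple tensor; hence
    the induction on \<open>t\<close>. The factor \<open>x\<close> passes to the left entry as the
    adjoint \<open>L x\<close>.\<close>
  have test: "tensor_inner I I (a \<otimes>\<^sub>v b) ((m \<otimes>\<^sub>l id) (associator_inv (x \<otimes>\<^sub>v t))) =
      tensor_inner I I (L x a \<otimes>\<^sub>v b) t" for a b x t
  proof (induction t rule: tensor_induct)
    case (vec y z)
    show ?case
      unfolding associator_inv_vec(2) tensor_map_vec(2)[OF m clinear_id]
      by (simp add: tensor_inner_sesquilinear(1)[OF I I] L)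
  next
    case (add s t)
    have "(m \<otimes>\<^sub>l id) (associator_inv (x \<otimes>\<^sub>v (s + t))) =
        (m \<otimes>\<^sub>l id) (associator_inv (x \<otimes>\<^sub>v s)) + (m \<otimes>\<^sub>l id) (associator_inv (x \<otimes>\<^sub>v t))"
      by (simp only: tensor_vec_simps clinear_add[OF associator_inv_vec(1)]
          clinear_add[OF tensor_map_vec(1)[OF m clinear_id]])
    then show ?case by (simp only: add tensor_inner_sesquilinear(2)[OF I I])
  qed
  have lin: "clinear ((m \<otimes>\<^sub>l id) \<circ> associator_inv \<circ> (id \<otimes>\<^sub>l m'))" "clinear (m' \<circ> m)"
    by (intro clinear_comp associator_inv_vec(1) tensor_map_vec(1) clinear_id m m'(1))+
  have "(m \<otimes>\<^sub>l id) \<circ> associator_inv \<circ> (id \<otimes>\<^sub>l m') = m' \<circ> m \<longleftrightarrow>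
      (\<forall>x y. (m \<otimes>\<^sub>l id) (associator_inv (x \<otimes>\<^sub>v m' y)) = m' (m (x \<otimes>\<^sub>v y)))"
    by (subst clinear_tensor_eq_iff[OF lin]) (simp add: tensor_map_vec(2)[OF clinear_id m'(1)])
  also have "\<dots> \<longleftrightarrow> (\<forall>x y a b. tensor_inner I I (a \<otimes>\<^sub>v b) ((m \<otimes>\<^sub>l id) (associator_inv (x \<otimes>\<^sub>v m' y))) =
      tensor_inner I I (a \<otimes>\<^sub>v b) (m' (m (x \<otimes>\<^sub>v y))))"
    using tensor_inner_eqI[OF I I] by metis
  also have "\<dots> \<longleftrightarrow> (\<forall>x y a b. I (m (L x a \<otimes>\<^sub>v b)) y = I (L x (m (a \<otimes>\<^sub>v b))) y)"
    by (simp only: test m'(2) L)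
  also have "\<dots> \<longleftrightarrow> (\<forall>x a b. L x (m (a \<otimes>\<^sub>v b)) = m (L x a \<otimes>\<^sub>v b))"
    using cinner_eqI[OF I] cinner_commute[OF I] by metis
  finally show ?thesis by (simp only: L_def)
qed

lemma frobenius_right_iff:
  "m' \<circ> m = (id \<otimes>\<^sub>l m) \<circ> associator \<circ> (m' \<otimes>\<^sub>l id) \<longleftrightarrow>
   (\<forall>y a b. adjoint I I (\<lambda>x. m (x \<otimes>\<^sub>v y)) (m (a \<otimes>\<^sub>v b)) = m (a \<otimes>\<^sub>v adjoint I I (\<lambda>x. m (x \<otimes>\<^sub>v y)) b))"
proof -
  define R where "R y = adjoint I I (\<lambda>x. m (x \<otimes>\<^sub>v y))" for y
  have R: "I (R y a) x = I a (m (x \<otimes>\<^sub>v y))" for x a y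
    using adjoint_eq[OF I I clinear_mult_tensor_vec(2)[OF m], of x y a]
      cinner_commute[OF I] by (metis R_def)
  \<comment> \<open>The mirror image, for \<open>t = m' x\<close>: right multiplication by
    \<open>y\<close> passes to the right entry as its adjoint \<open>R y\<close>.\<close>
  have test: "tensor_inner I I (a \<otimes>\<^sub>v b) ((id \<otimes>\<^sub>l m) (associator (t \<otimes>\<^sub>v y))) =
      tensor_inner I I (a \<otimes>\<^sub>v R y b) t" for a b y t
  proof (induction t rule: tensor_induct)
    case (vec x z)
    show ?case
      unfolding associator_vec(2) tensor_map_vec(2)[OF clinear_id m]
      by (simp add: tensor_inner_sesquilinear(1)[OF I I] R)
  next
    case (add s t)
    have "(id \<otimes>\<^sub>l m) (associator ((s + t) \<otimes>\<^sub>v y)) =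
        (id \<otimes>\<^sub>l m) (associator (s \<otimes>\<^sub>v y)) + (id \<otimes>\<^sub>l m) (associator (t \<otimes>\<^sub>v y))"
      by (simp only: tensor_vec_simps clinear_add[OF associator_vec(1)]
          clinear_add[OF tensor_map_vec(1)[OF clinear_id m]])
    then show ?case by (simp only: add tensor_inner_sesquilinear(2)[OF I I])
  qed
  have lin: "clinear (m' \<circ> m)" "clinear ((id \<otimes>\<^sub>l m) \<circ> associator \<circ> (m' \<otimes>\<^sub>l id))"
    by (intro clinear_comp associator_vec(1) tensor_map_vec(1) clinear_id m m'(1))+
  have "m' \<circ> m = (id \<otimes>\<^sub>l m) \<circ> associator \<circ> (m' \<otimes>\<^sub>l id) \<longleftrightarrow>
      (\<forall>x y. m' (m (x \<otimes>\<^sub>v y)) = (id \<otimes>\<^sub>l m) (associator (m' x \<otimes>\<^sub>v y)))"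
    by (subst clinear_tensor_eq_iff[OF lin]) (simp add: tensor_map_vec(2)[OF m'(1) clinear_id])
  also have "\<dots> \<longleftrightarrow> (\<forall>x y a b. tensor_inner I I (a \<otimes>\<^sub>v b) (m' (m (x \<otimes>\<^sub>v y))) =
      tensor_inner I I (a \<otimes>\<^sub>v b) ((id \<otimes>\<^sub>l m) (associator (m' x \<otimes>\<^sub>v y))))"
    using tensor_inner_eqI[OF I I] by metis
  also have "\<dots> \<longleftrightarrow> (\<forall>x y a b. I (R y (m (a \<otimes>\<^sub>v b))) x = I (m (a \<otimes>\<^sub>v R y b)) x)"
    by (simp only: test m'(2) R)
  also have "\<dots> \<longleftrightarrow> (\<forall>y a b. R y (m (a \<otimes>\<^sub>v b)) = m (a \<otimes>\<^sub>v R y b))"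
    using cinner_eqI[OF I] cinner_commute[OF I] by metis
  finally show ?thesis by (simp only: R_def)
qed

end

section \<open>The axioms in elementwise form\<close>

lemma adjoint_scalar:
  fixes i :: "complex \<Rightarrow> 'a::complex_vector"
  assumes "is_cinner I" "clinear i"
  shows "adjoint scalar_inner I i = I (i 1)"
  using adjoint_eq[OF is_cinner_scalar assms, of 1] by (auto simp: scalar_inner_def)

lemma normalized_cstar_frobenius_iff:
  fixes X :: "'a::fd_complex_vector frobenius"
  defines "I \<equiv> fip X" and "m \<equiv> fmult X" and "e \<equiv> funit X 1"
  shows "normalized_cstar_frobenius X \<longleftrightarrow>
    is_cinner I \<and> clinear m \<and> clinear (funit X) \<and>
    (\<forall>x y z. m (m (x \<otimes>\<^sub>v y) \<otimes>\<^sub>v z) = m (x \<otimes>\<^sub>v m (y \<otimes>\<^sub>v z))) \<and>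
    (\<forall>x. m (e \<otimes>\<^sub>v x) = x) \<and> (\<forall>x. m (x \<otimes>\<^sub>v e) = x) \<and>
    (\<forall>x a b. adjoint I I (\<lambda>y. m (x \<otimes>\<^sub>v y)) (m (a \<otimes>\<^sub>v b)) = m (adjoint I I (\<lambda>y. m (x \<otimes>\<^sub>v y)) a \<otimes>\<^sub>v b)) \<and>
    (\<forall>y a b. adjoint I I (\<lambda>x. m (x \<otimes>\<^sub>v y)) (m (a \<otimes>\<^sub>v b)) = m (a \<otimes>\<^sub>v adjoint I I (\<lambda>x. m (x \<otimes>\<^sub>v y)) b)) \<and>
    I e e = 1"
proof -
  have norm: "funit_adj X \<circ> funit X = id \<longleftrightarrow> I e e = 1" if I: "is_cinner I" and i: "clinear (funit X)"
  proof -
    have "(funit_adj X \<circ> funit X) c = c * I e e" for c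
      using adjoint_scalar[OF I i] clinear_from_complex[OF i, of c]
      by (simp add: funit_adj_def I_def e_def cinner_simps[OF I[unfolded I_def]])
    then have "funit_adj X \<circ> funit X = id \<longleftrightarrow> (\<forall>c. c * I e e = c)"
      by (simp only: fun_eq_iff id_apply)
    also have "\<dots> \<longleftrightarrow> I e e = 1" by (metis mult.right_neutral mult_1)
    finally show ?thesis .
  qed
  show ?thesis
  \<comment> \<open>The translations of the single axioms hold only under these three conditions;
    where they fail, both sides are false.\<close>
  proof (cases "is_cinner I \<and> clinear m \<and> clinear (funit X)")
    case True
    then have I: "is_cinner I" and m: "clinear m" and i: "clinear (funit X)" by blast+
    show ?thesis
      unfolding normalized_cstar_frobenius_def Let_def fmult_adj_def I_def[symmetric] m_def[symmetric]
        norm[OF I i] associativity_iff[OF m] unitality_iff[OF m i, folded e_def]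
        frobenius_left_iff[OF I m refl] frobenius_right_iff[OF I m refl] ..
  next
    case False
    then show ?thesis unfolding normalized_cstar_frobenius_def Let_def I_def m_def by blast
  qed
qed

section \<open>Frobenius algebras as unital Hilbert algebras\<close>

lemma funit_adj_eq: "normalized_cstar_frobenius X \<Longrightarrow> funit_adj X = fip X (funit X 1)"
  unfolding normalized_cstar_frobenius_iff funit_adj_def by (simp add: adjoint_scalar)

text \<open>Since the adjoint of the unit is the inner product with \<open>funit X 1\<close>, the
  defining relation of \<open>S v\<close> is the adjoint relation of left multiplication by
  \<open>v\<close> at the unit.\<close>

lemma frobenius_S_eq:
  fixes X :: "'a::fd_complex_vector frobenius"
  assumes X: "normalized_cstar_frobenius X"
  shows "frobenius_S X v = adjoint (fip X) (fip X) (\<lambda>y. fmult X (v \<otimes>\<^sub>v y)) (funit X 1)" (is "_ = ?u")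
proof -
  have I: "is_cinner (fip X)" and m: "clinear (fmult X)"
    using X by (simp_all add: normalized_cstar_frobenius_iff)
  have u: "fip X ?u w = funit_adj X (fmult X (v \<otimes>\<^sub>v w))" for w
    using adjoint_eq[OF I I clinear_mult_tensor_vec(1)[OF m], of v w "funit X 1"] cinner_commute[OF I]
    unfolding funit_adj_eq[OF X] by metis
  show ?thesis
    unfolding frobenius_S_def
  proof (rule the_equality)
    show "z = ?u" if "\<forall>w. fip X z w = funit_adj X (fmult X (v \<otimes>\<^sub>v w))" for z
      by (rule cinner_eqI[OF I]) (metis that u cinner_commute[OF I])
  qed (simp add: u)
qed

lemma unital_hilbert_algebra_frobenius:
  fixes X :: "'a::fd_complex_vector frobenius"
  assumes X: "normalized_cstar_frobenius X"
  shows "unital_hilbert_algebra (fip X) (\<lambda>x y. fmult X (x \<otimes>\<^sub>v y)) (funit X 1) (frobenius_S X)"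
proof -
  have I: "is_cinner (fip X)" and m: "clinear (fmult X)"
    and assoc: "fmult X (fmult X (x \<otimes>\<^sub>v y) \<otimes>\<^sub>v z) = fmult X (x \<otimes>\<^sub>v fmult X (y \<otimes>\<^sub>v z))"
    and unit: "fmult X (funit X 1 \<otimes>\<^sub>v x) = x" "fmult X (x \<otimes>\<^sub>v funit X 1) = x"
    and frob: "adjoint (fip X) (fip X) (\<lambda>y. fmult X (x \<otimes>\<^sub>v y)) (fmult X (a \<otimes>\<^sub>v b)) =
      fmult X (adjoint (fip X) (fip X) (\<lambda>y. fmult X (x \<otimes>\<^sub>v y)) a \<otimes>\<^sub>v b)"
    and one: "fip X (funit X 1) (funit X 1) = 1" for x y z a b
    using X unfolding normalized_cstar_frobenius_iff by blast+
  show ?thesis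
  proof (rule unital_hilbert_algebra.intro)
    show "cbilinear (\<lambda>x y. fmult X (x \<otimes>\<^sub>v y))"
      using clinear_mult_tensor_vec[OF m] by (simp add: cbilinear_def)
    show "fip X (fmult X (x \<otimes>\<^sub>v y)) z = fip X y (fmult X (frobenius_S X x \<otimes>\<^sub>v z))" for x y z
      \<comment> \<open>The first Frobenius identity with \<open>a\<close> the unit makes the
        adjoint of left multiplication by \<open>x\<close> left multiplication by
        \<open>S x\<close>.\<close>
      using adjoint_eq[OF I I clinear_mult_tensor_vec(1)[OF m], of x y z] frob[of x "funit X 1" z]
      by (simp add: frobenius_S_eq[OF X] unit)
  qed (fact I assoc unit one)+
qed

lemma (in unital_hilbert_algebra) normalized_cstar_frobenius_mul:
  "normalized_cstar_frobenius \<lparr>fip = I, fmult = tensor_lift (\<cdot>), funit = \<lambda>c. c *\<^sub>C e\<rparr>"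
proof -
  have unit: "clinear (\<lambda>c. c *\<^sub>C e)"
    by (rule clinearI) (simp_all add: scaleC_add_left scaleC_scaleC scaleC_complex_mult)
  show ?thesis
    by (simp add: normalized_cstar_frobenius_iff inner unit unit_normalized clinear_tensor_lift
        tensor_lift_vec bilinear assoc scaleC_one left_unit right_unit left_adjoint_eq right_adjoint)
qed

section \<open>The correspondence\<close>

text \<open>The norm belongs to the target data, so one has to be chosen; uniqueness of the C*-norm
  makes this choice compatible with surjectivity.\<close>

definition cstar_of_frobenius :: "'a::fd_complex_vector frobenius \<Rightarrow> 'a cstar \<times> ('a \<Rightarrow> complex)" where
  "cstar_of_frobenius X =
     (\<lparr>cmult = \<lambda>x y. fmult X (x \<otimes>\<^sub>v y), cone = funit X 1, cstar = frobenius_S X,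
       cnorm = \<lambda>x. opnorm (fip X) (\<lambda>y. fmult X (x \<otimes>\<^sub>v y))\<rparr>, funit_adj X)"

text \<open>Forgets the norm of the algebra, which \<open>frobenius_of_cstar_props\<close>
  recovers.\<close>

definition frobenius_of_cstar :: "'a::fd_complex_vector cstar \<times> ('a \<Rightarrow> complex) \<Rightarrow> 'a frobenius" where
  "frobenius_of_cstar = (\<lambda>(A, \<omega>).
     \<lparr>fip = gns_inner A \<omega>, fmult = tensor_lift (cmult A), funit = \<lambda>c. c *\<^sub>C cone A\<rparr>)"

lemma cstar_of_frobenius_props:
  fixes X :: "'a::fd_complex_vector frobenius"
  assumes X: "normalized_cstar_frobenius X" and A: "cstar_of_frobenius X = (A, \<omega>)"
  shows "cstar_algebra A" "faithful_state A \<omega>" "fip X = gns_inner A \<omega>"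
    "frobenius_S X = tomita_operator A" "frobenius_of_cstar (A, \<omega>) = X"
proof -
  interpret unital_hilbert_algebra "fip X" "\<lambda>x y. fmult X (x \<otimes>\<^sub>v y)" "funit X 1" "frobenius_S X"
    by (rule unital_hilbert_algebra_frobenius[OF X])
  have A_eq: "A = \<lparr>cmult = \<lambda>x y. fmult X (x \<otimes>\<^sub>v y), cone = funit X 1, cstar = frobenius_S X, cnorm = mul_norm\<rparr>"
    and \<omega>_eq: "\<omega> = fip X (funit X 1)"
    using A by (simp_all add: cstar_of_frobenius_def funit_adj_eq[OF X])
  show alg: "cstar_algebra A" unfolding A_eq by (rule cstar_algebra_mul_norm)
  show "faithful_state A \<omega>" unfolding A_eq \<omega>_eq by (rule faithful_state_unit)
  show ip: "fip X = gns_inner A \<omega>" by (simp add: fun_eq_iff gns_inner_def A_eq \<omega>_eq inner_unit)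
  show "frobenius_S X = tomita_operator A" unfolding tomita_operator_eq[OF alg] by (simp add: A_eq)
  have m: "clinear (fmult X)" and i: "clinear (funit X)"
    using X by (simp_all add: normalized_cstar_frobenius_iff)
  have "tensor_lift (cmult A) = fmult X"
    by (subst clinear_tensor_eq_iff) (simp_all add: A_eq bilinear clinear_tensor_lift tensor_lift_vec m)
  moreover have "(\<lambda>c. c *\<^sub>C cone A) = funit X"
    by (rule ext) (simp add: A_eq clinear_from_complex[OF i, symmetric])
  ultimately show "frobenius_of_cstar (A, \<omega>) = X"
    by (simp add: frobenius_of_cstar_def flip: ip)
qed

lemma frobenius_of_cstar_props:
  fixes A :: "'a::fd_complex_vector cstar"
  assumes A: "cstar_algebra A" and \<omega>: "faithful_state A \<omega>"
  shows "normalized_cstar_frobenius (frobenius_of_cstar (A, \<omega>))"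
    "cstar_of_frobenius (frobenius_of_cstar (A, \<omega>)) = (A, \<omega>)"
proof -
  interpret unital_hilbert_algebra "gns_inner A \<omega>" "cmult A" "cone A" "cstar A"
    by (rule unital_hilbert_algebra_gns[OF A \<omega>])
  define X where "X = frobenius_of_cstar (A, \<omega>)"
  have X_sel: "fip X = gns_inner A \<omega>" "fmult X (x \<otimes>\<^sub>v y) = cmult A x y" "funit X 1 = cone A" for x y
    by (simp_all add: X_def frobenius_of_cstar_def tensor_lift_vec bilinear scaleC_one)
  show X: "normalized_cstar_frobenius (frobenius_of_cstar (A, \<omega>))"
    using normalized_cstar_frobenius_mul by (simp add: frobenius_of_cstar_def)
  then have X: "normalized_cstar_frobenius X" by (simp add: X_def)
  have A_rec: "cstar_algebra \<lparr>cmult = cmult A, cone = cone A, cstar = cstar A, cnorm = cnorm A\<rparr>"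
    using A by (cases A) simp
  \<comment> \<open>Uniqueness of the C*-norm, from the two bounds above: the given norm is the one
    that \<open>cstar_of_frobenius\<close> reconstructs.\<close>
  have "cnorm A x = mul_norm x" for x
    using mul_norm_le_cstar_norm[OF A_rec] cstar_norm_le_mul_norm[OF A_rec] by (rule antisym[rotated])
  moreover have "frobenius_S X = cstar A"
    by (simp add: fun_eq_iff frobenius_S_eq[OF X] X_sel left_adjoint_eq right_unit)
  moreover have "funit_adj X = \<omega>"
    by (simp add: fun_eq_iff funit_adj_eq[OF X] X_sel gns_inner_def star_unit left_unit)
  ultimately show "cstar_of_frobenius (frobenius_of_cstar (A, \<omega>)) = (A, \<omega>)"
    unfolding X_def[symmetric] cstar_of_frobenius_def
    by (simp add: X_sel) (rule cstar.equality; simp add: fun_eq_iff)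
qed

theorem proposition6p28:
  shows "\<exists>\<Phi> :: 'a::fd_complex_vector frobenius \<Rightarrow> 'a cstar \<times> ('a \<Rightarrow> complex).
    bij_betw \<Phi> {X. normalized_cstar_frobenius X}
      {(A, \<omega>). cstar_algebra A \<and> faithful_state A \<omega>} \<and>
    (\<forall>X A \<omega>. normalized_cstar_frobenius X \<and> \<Phi> X = (A, \<omega>) \<longrightarrow>
      (\<forall>x y. fmult X (x \<otimes>\<^sub>v y) = cmult A x y) \<and>
      funit X 1 = cone A \<and>
      funit_adj X = \<omega> \<and>
      fip X = gns_inner A \<omega> \<and>
      (\<forall>v w. funit_adj X (fmult X (v \<otimes>\<^sub>v w)) = fip X (frobenius_S X v) w) \<and>
      antilinear (frobenius_S X) \<and> frobenius_S X \<circ> frobenius_S X = id \<and>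
      frobenius_S X = tomita_operator A)"
proof (intro exI[of _ cstar_of_frobenius] conjI allI impI; (elim conjE)?)
  show "bij_betw cstar_of_frobenius {X :: 'a frobenius. normalized_cstar_frobenius X}
      {(A, \<omega>). cstar_algebra A \<and> faithful_state A \<omega>}"
  proof (rule bij_betw_byWitness[where f' = frobenius_of_cstar])
    show "\<forall>X\<in>{X :: 'a frobenius. normalized_cstar_frobenius X}. frobenius_of_cstar (cstar_of_frobenius X) = X"
      using cstar_of_frobenius_props(5) by (metis mem_Collect_eq surj_pair)
    show "cstar_of_frobenius ` {X :: 'a frobenius. normalized_cstar_frobenius X} \<subseteq>
        {(A, \<omega>). cstar_algebra A \<and> faithful_state A \<omega>}"
      by (auto dest: cstar_of_frobenius_props(1,2)[OF _ sym])
  qed (auto simp: frobenius_of_cstar_props)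
next
  fix X :: "'a frobenius" and A \<omega> v w
  assume X: "normalized_cstar_frobenius X" and A: "cstar_of_frobenius X = (A, \<omega>)"
  interpret unital_hilbert_algebra "fip X" "\<lambda>x y. fmult X (x \<otimes>\<^sub>v y)" "funit X 1" "frobenius_S X"
    by (rule unital_hilbert_algebra_frobenius[OF X])
  show "fip X = gns_inner A \<omega>" "frobenius_S X = tomita_operator A"
    using cstar_of_frobenius_props[OF X A] by blast+
  show "antilinear (frobenius_S X)" by (rule antilinear_star)
  show "frobenius_S X \<circ> frobenius_S X = id" by (simp add: fun_eq_iff star_star)
  show "funit_adj X (fmult X (v \<otimes>\<^sub>v w)) = fip X (frobenius_S X v) w"
    \<comment> \<open>\<open>inner_unit\<close> is used at \<open>S v\<close>, where
      \<open>S (S v) = v\<close> returns the product of \<open>v\<close> and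
      \<open>w\<close>.\<close>
    using inner_unit[of "frobenius_S X v" w] by (simp add: funit_adj_eq[OF X] star_star)
qed (auto simp: cstar_of_frobenius_def)

end
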